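(* Let $q$ be a prime power and let $r,s,d$ be integers with $1<s<r$ and $d\ge 2$. Let $\boldsymbol a\in\mathbb{F}_q^{r-s}$, and let $N$ be the number of $\boldsymbol F_s=(F_1,\ldots,F_s)\in\mathcal{F}_d^s$ such that $\boldsymbol F_s(\boldsymbol a,-)=(F_1(\boldsymbol a,-),\ldots,F_s(\boldsymbol a,-))$ forms a reduced regular sequence in $\mathbb{F}_q[X_{r-s+1},\ldots,X_r]$. If $q>2d^s(d+1)^s$, then $$1-\frac{2d^s(d+1)^s}{q}\le\frac{N}{|\mathcal{F}_d^s|}\le 1.$$
   Context: $\mathbb{F}_q$ is the finite field with $q$ elements. $\mathcal{F}_d$ denotes the set of all polynomials in $\mathbb{F}_q[X_1,\ldots,X_r]$ of degree at most $d$ (including the zero polynomial), and $\mathcal{F}_d^s=\mathcal{F}_d\times\cdots\times\mathcal{F}_d$ ($s$ times). For $F\in\mathcal{F}_d$ and $\boldsymbol a\in\mathbb{F}_q^{r-s}$, $F(\boldsymbol a,-):=F(\boldsymbol a,X_{r-s+1},\ldots,X_r)$. Polynomials $G_1,\ldots,G_s$ in a polynomial ring $R$ over a field form a regular sequence if $(G_1,\ldots,G_s)$ is a proper ideal of $R$, $G_1\neq 0$, and for each $2\le i\le s$, $G_i$ is neither zero nor a zero divisor in $R/(G_1,\ldots,G_{i-1})$. They form a reduced regular sequence if, in addition, $(G_1,\ldots,G_i)$ is a radical ideal of $R$ for $1\le i\le s$. *)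

theory Defs
  imports
    Complex_Main
    "HOL-Library.Poly_Mapping"
    "HOL-Library.Cardinality"
    "HOL-Algebra.QuotRing"
begin

text \<open>
  A monomial is a finitely supported map from variable indices to exponents, and a polynomial is a
  finitely supported map from monomials to coefficients.  The type contains the polynomials in all
  variables \<open>X\<^sub>i\<close>, \<open>i :: nat\<close>; the ring of polynomials in a given set of variables is carved out
  as a carrier set below.
\<close>

type_synonym monomial = "nat \<Rightarrow>\<^sub>0 nat"

type_synonym 'a mpoly = "monomial \<Rightarrow>\<^sub>0 'a"

definition Const :: "'a::zero \<Rightarrow> 'a mpoly" where
  "Const c = Poly_Mapping.single 0 c"

definition Var :: "nat \<Rightarrow> 'a::zero_neq_one mpoly" where
  "Var i = Poly_Mapping.single (Poly_Mapping.single i 1) 1"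

definition vars :: "'a::zero mpoly \<Rightarrow> nat set" where
  "vars F = (\<Union>m \<in> Poly_Mapping.keys F. Poly_Mapping.keys m)"

definition mono_degree :: "monomial \<Rightarrow> nat" where
  "mono_degree m = (\<Sum>i \<in> Poly_Mapping.keys m. Poly_Mapping.lookup m i)"

definition poly_ring :: "nat set \<Rightarrow> 'a::comm_ring_1 mpoly ring" where
  "poly_ring V = \<lparr>carrier = {F. vars F \<subseteq> V}, mult = (*), one = 1, zero = 0, add = (+)\<rparr>"

definition polys_upto :: "nat \<Rightarrow> nat \<Rightarrow> 'a::comm_ring_1 mpoly set" where
  "polys_upto r d =
     {F \<in> carrier (poly_ring {1..r}). \<forall>m \<in> Poly_Mapping.keys F. mono_degree m \<le> d}"

definition poly_subst :: "(nat \<Rightarrow> 'a mpoly) \<Rightarrow> 'a::comm_ring_1 mpoly \<Rightarrow> 'a mpoly" where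
  "poly_subst \<sigma> F =
     (\<Sum>m \<in> Poly_Mapping.keys F. Const (Poly_Mapping.lookup F m) *
        (\<Prod>i \<in> Poly_Mapping.keys m. \<sigma> i ^ Poly_Mapping.lookup m i))"

text \<open>
  \<open>F(a, -)\<close>: the entries \<open>a\<^sub>1, \<dots>, a\<^sub>n\<close> of the list \<open>a\<close> are substituted for \<open>X\<^sub>1, \<dots>, X\<^sub>n\<close>, and the
  remaining variables keep their names.  Lists are indexed from 0, variables from 1.
\<close>

definition partial_eval :: "'a list \<Rightarrow> 'a::comm_ring_1 mpoly \<Rightarrow> 'a mpoly" where
  "partial_eval a =
     poly_subst (\<lambda>i. if i \<in> {1..length a} then Const (a ! (i - 1)) else Var i)"

definition zero_divisor :: "('a, 'b) ring_scheme \<Rightarrow> 'a \<Rightarrow> bool" where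
  "zero_divisor R x \<longleftrightarrow>
     x \<in> carrier R \<and> (\<exists>y \<in> carrier R. y \<noteq> \<zero>\<^bsub>R\<^esub> \<and> x \<otimes>\<^bsub>R\<^esub> y = \<zero>\<^bsub>R\<^esub>)"

definition radical :: "('a, 'b) ring_scheme \<Rightarrow> 'a set \<Rightarrow> 'a set" where
  "radical R I = {x \<in> carrier R. \<exists>n::nat. x [^]\<^bsub>R\<^esub> n \<in> I}"

definition radical_ideal :: "('a, 'b) ring_scheme \<Rightarrow> 'a set \<Rightarrow> bool" where
  "radical_ideal R I \<longleftrightarrow> ideal I R \<and> radical R I = I"

text \<open>
  The sequence \<open>G\<^sub>1, \<dots>, G\<^sub>s\<close> is a nonempty list with \<open>G\<^sub>i = Gs ! (i - 1)\<close>, so that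
  \<open>(G\<^sub>1, \<dots>, G\<^sub>i)\<close> is the ideal generated by \<open>set (take i Gs)\<close>.
\<close>

definition regular_sequence :: "('a, 'b) ring_scheme \<Rightarrow> 'a list \<Rightarrow> bool" where
  "regular_sequence R Gs \<longleftrightarrow>
     Gs \<noteq> [] \<and> set Gs \<subseteq> carrier R \<and>
     Idl\<^bsub>R\<^esub> (set Gs) \<noteq> carrier R \<and>
     Gs ! 0 \<noteq> \<zero>\<^bsub>R\<^esub> \<and>
     (\<forall>i \<in> {2..length Gs}.
        let I = Idl\<^bsub>R\<^esub> (set (take (i - 1) Gs)); Q = R Quot I; g = I +>\<^bsub>R\<^esub> (Gs ! (i - 1))
        in g \<noteq> \<zero>\<^bsub>Q\<^esub> \<and> \<not> zero_divisor Q g)"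

definition reduced_regular_sequence :: "('a, 'b) ring_scheme \<Rightarrow> 'a list \<Rightarrow> bool" where
  "reduced_regular_sequence R Gs \<longleftrightarrow>
     regular_sequence R Gs \<and>
     (\<forall>i \<in> {1..length Gs}. radical_ideal R (Idl\<^bsub>R\<^esub> (set (take i Gs))))"

lemma vars_0 [simp]: "vars 0 = {}"
  by (simp add: vars_def)

lemma vars_1 [simp]: "vars (1 :: 'a::comm_ring_1 mpoly) = {}"
  by (simp add: vars_def)

lemma vars_uminus [simp]: "vars (- F) = vars (F :: 'a::comm_ring_1 mpoly)"
  by (simp add: vars_def)

lemma vars_add: "vars (F + G) \<subseteq> vars F \<union> vars (G :: 'a::comm_ring_1 mpoly)"
  using Poly_Mapping.keys_add[of F G] by (auto simp: vars_def)

lemma vars_mult: "vars (F * G) \<subseteq> vars F \<union> vars (G :: 'a::comm_ring_1 mpoly)"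
proof
  fix i assume "i \<in> vars (F * G)"
  then obtain m where m: "m \<in> Poly_Mapping.keys (F * G)" "i \<in> Poly_Mapping.keys m"
    by (auto simp: vars_def)
  then obtain u v where uv: "m = u + v" "u \<in> Poly_Mapping.keys F" "v \<in> Poly_Mapping.keys G"
    using keys_mult[of F G] by blast
  then have "i \<in> Poly_Mapping.keys u \<union> Poly_Mapping.keys v"
    using m(2) Poly_Mapping.keys_add[of u v] by blast
  with uv show "i \<in> vars F \<union> vars G"
    by (auto simp: vars_def)
qed

lemma cring_poly_ring: "cring (poly_ring V :: 'a::comm_ring_1 mpoly ring)"
proof -
  have add: "vars (x + y) \<subseteq> V" if "vars x \<subseteq> V" "vars y \<subseteq> V" for x y :: "'a mpoly"
    using vars_add[of x y] that by blast
  have mult: "vars (x * y) \<subseteq> V" if "vars x \<subseteq> V" "vars y \<subseteq> V" for x y :: "'a mpoly"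
    using vars_mult[of x y] that by blast
  have neg: "\<exists>y. vars y \<subseteq> V \<and> x + y = 0" if "vars x \<subseteq> V" for x :: "'a mpoly"
    using that by (intro exI[of _ "- x"]) simp
  show ?thesis
  proof (rule cringI)
    show "abelian_group (poly_ring V :: 'a mpoly ring)"
      by (rule abelian_groupI) (simp_all add: poly_ring_def add neg Bex_def add.assoc add.commute)
    show "comm_monoid (poly_ring V :: 'a mpoly ring)"
      by (rule comm_monoidI) (simp_all add: poly_ring_def mult mult.assoc mult.commute)
  qed (simp add: poly_ring_def distrib_right)
qed

lemma finite_monomials:
  "finite {m. Poly_Mapping.keys m \<subseteq> {1..r} \<and> mono_degree m \<le> d}" (is "finite ?M")
proof (rule finite_imageD)
  show "inj_on Poly_Mapping.lookup ?M"
    by (simp add: inj_on_def)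
  have "Poly_Mapping.lookup m i \<le> d" if "mono_degree m \<le> d" for m i
  proof (cases "i \<in> Poly_Mapping.keys m")
    case True
    then have "Poly_Mapping.lookup m i \<le> mono_degree m"
      unfolding mono_degree_def by (intro member_le_sum) auto
    with that show ?thesis by simp
  qed (simp add: in_keys_iff)
  then have "Poly_Mapping.lookup ` ?M \<subseteq>
      {f. \<forall>i. (i \<in> {1..r} \<longrightarrow> f i \<in> {..d}) \<and> (i \<notin> {1..r} \<longrightarrow> f i = 0)}"
    by (auto simp: in_keys_iff subset_iff)
  then show "finite (Poly_Mapping.lookup ` ?M)"
    by (rule finite_subset) (intro finite_set_of_finite_funs; simp)
qed

lemma finite_polys_upto:
  "finite (polys_upto r d :: 'a::{comm_ring_1,finite} mpoly set)" (is "finite ?P")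
proof (rule finite_imageD)
  let ?M = "{m. Poly_Mapping.keys m \<subseteq> {1..r} \<and> mono_degree m \<le> d}"
  show "inj_on Poly_Mapping.lookup ?P"
    by (simp add: inj_on_def)
  have "Poly_Mapping.lookup ` ?P \<subseteq>
      {f. \<forall>m. (m \<in> ?M \<longrightarrow> f m \<in> UNIV) \<and> (m \<notin> ?M \<longrightarrow> f m = 0)}"
  proof (rule image_subsetI)
    fix F assume "F \<in> ?P"
    then have "Poly_Mapping.keys F \<subseteq> ?M"
      by (auto simp: polys_upto_def poly_ring_def vars_def)
    then have "m \<notin> Poly_Mapping.keys F" if "m \<notin> ?M" for m
      using that by (rule contra_subsetD)
    then show "Poly_Mapping.lookup F \<in>
        {f. \<forall>m. (m \<in> ?M \<longrightarrow> f m \<in> UNIV) \<and> (m \<notin> ?M \<longrightarrow> f m = 0)}"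
      unfolding in_keys_iff by blast
  qed
  then show "finite (Poly_Mapping.lookup ` ?P)"
    by (rule finite_subset) (rule finite_set_of_finite_funs[OF finite_monomials finite])
qed

end

theory Submission
  imports Defs "HOL-Computational_Algebra.Primes"
begin

text \<open>
  After the substitution of \<open>a\<close> there remain \<open>s\<close> polynomials \<open>G\<^sub>v\<close> of degree at most \<open>d\<close> in the \<open>s\<close>
  variables \<open>X\<^sub>v\<close>, \<open>v \<in> V\<close>.  If \<open>H\<close> is a system in these variables only, then the line \<open>F + c H\<close> is
  mapped to the line \<open>G + c H\<close>.  The space of all \<open>F\<close> is a disjoint union of such lines, each with
  \<open>q\<close> points, so a bound \<open>D\<close> for the number of bad \<open>c\<close> on every line bounds the proportion of bad
  \<open>F\<close> by \<open>D / q\<close> (\<open>card_bad_translates_le\<close>).  The bad \<open>c\<close> are those for which a family of vectors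
  \<open>a\<^sub>i + c b\<^sub>i\<close>, with the \<open>b\<^sub>i\<close> independent, becomes dependent; as with eigenvalues of an operator,
  there are at most as many of them as vectors in the family (\<open>card_dependent_pencil_le\<close>).  Two
  families of this kind are used, both in degree at most
  \<open>t = (s + 1) (d - 1)\<close>; let \<open>M\<close> be the number of monomials of degree at most \<open>t\<close>.

  The first family has \<open>M\<close> members: a monomial with all exponents below \<open>d\<close> is kept, and any other
  monomial has one factor \<open>X\<^sub>v\<^sup>d\<close> replaced by \<open>G\<^sub>v\<close>.  If it is independent, then the linear map which
  sends \<open>X\<^sup>m\<close> to \<open>X\<^bsup>m mod d\<^esup> G\<^bsup>m div d\<^esup>\<close> is a bijection of the polynomial ring (\<open>adic_surj\<close>,
  \<open>adic_eq_0\<close>).  It turns multiplication by \<open>X\<^sub>v\<^sup>d\<close> into multiplication by \<open>G\<^sub>v\<close>, so the ideals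
  generated by some of the \<open>G\<^sub>v\<close> are images of monomial ideals, and \<open>G\<close> is a regular sequence because
  the powers \<open>X\<^sub>v\<^sup>d\<close> are.  It also follows that all ideals generated by a part of \<open>G\<close> are radical as
  soon as the ideal generated by all of \<open>G\<close> is (\<open>radical_closed_subset\<close>).

  The second family has \<open>s M\<close> members, and its independence makes the Jacobian matrix of \<open>G\<close>
  invertible modulo \<open>G\<close> (\<open>radical_closed_of_indep_jac\<close>).  The quotient by \<open>G\<close> is a finite ring, so
  some power \<open>x \<mapsto> x\<^sup>Q\<close> of the Frobenius map acts idempotently on it; the elements \<open>X\<^sub>v - X\<^sub>v\<^sup>Q\<close> are
  nilpotent, and since \<open>G(X\<^sup>Q) = G\<^sup>Q\<close>, the Taylor formula and the inverse of the Jacobian matrix show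
  that they lie in the square of the ideal which they generate there.  Hence they vanish in the quotient,
  every element of which is then equal to its \<open>Q\<close>-th power, and the quotient is reduced
  (\<open>jacobian_radical_closed\<close>).

  The direction \<open>H\<close> is \<open>X\<^sub>v\<^sup>d\<close> for the first family, and \<open>X\<^sub>v\<^sup>d - 1\<close> or \<open>X\<^sub>v\<^sup>d + X\<^sub>v\<close> for the second.
  Altogether the proportion of bad systems is at most \<open>(s + 1) M / q\<close>, and
  \<open>(s + 1) M \<le> 2 d\<^sup>s (d + 1)\<^sup>s\<close> by \<open>Suc_mult_choose_le\<close>.
\<close>

section \<open>Independent families and pencils\<close>

text \<open>
  Vectors are functions \<open>'j \<Rightarrow> 'a\<close>, so that the same notion serves coefficient vectors of polynomials
  and of tuples of polynomials.
\<close>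

definition indep :: "('i \<Rightarrow> 'j \<Rightarrow> 'a::field) \<Rightarrow> 'i set \<Rightarrow> bool" where
  "indep w I \<longleftrightarrow> (\<forall>x. (\<forall>j. (\<Sum>i\<in>I. x i * w i j) = 0) \<longrightarrow> (\<forall>i\<in>I. x i = 0))"

lemma indepD:
  assumes "indep w I" "\<And>j. (\<Sum>i\<in>I. x i * w i j) = 0" "i \<in> I"
  shows "x i = 0"
  using assms unfolding indep_def by blast

lemma indep_subset:
  assumes "indep w I" "J \<subseteq> I" "finite I"
  shows "indep w J"
  unfolding indep_def
proof (intro allI impI ballI)
  fix x i assume *: "\<forall>j. (\<Sum>i\<in>J. x i * w i j) = 0" and i: "i \<in> J"
  have "(\<Sum>i\<in>I. (if i \<in> J then x i else 0) * w i j) = (\<Sum>i\<in>J. x i * w i j)" for j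
    using assms(2,3) by (intro sum.mono_neutral_cong_right) auto
  with * have "(if i \<in> J then x i else 0) = 0"
    using indepD[OF assms(1), of "\<lambda>i. if i \<in> J then x i else 0" i] assms(2) i by auto
  with i show "x i = 0"
    by simp
qed

lemma indep_cong:
  assumes "\<And>i. i \<in> I \<Longrightarrow> w i = w' i"
  shows "indep w I \<longleftrightarrow> indep w' I"
  unfolding indep_def using assms by (simp cong: sum.cong)

lemma inj_on_combination:
  fixes w :: "'i \<Rightarrow> 'j \<Rightarrow> 'a::{field,finite}"
  assumes "indep w I" and supp: "\<And>i j. i \<in> I \<Longrightarrow> j \<notin> J \<Longrightarrow> w i j = 0"
  shows "inj_on (\<lambda>x. restrict (\<lambda>j. \<Sum>i\<in>I. x i * w i j) J) (I \<rightarrow>\<^sub>E UNIV)"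
proof (rule inj_onI)
  fix x y :: "'i \<Rightarrow> 'a"
  assume x: "x \<in> I \<rightarrow>\<^sub>E UNIV" and y: "y \<in> I \<rightarrow>\<^sub>E UNIV"
    and eq: "restrict (\<lambda>j. \<Sum>i\<in>I. x i * w i j) J = restrict (\<lambda>j. \<Sum>i\<in>I. y i * w i j) J"
  have "(\<Sum>i\<in>I. (x i - y i) * w i j) = 0" for j
  proof (cases "j \<in> J")
    case True
    then have "(\<Sum>i\<in>I. x i * w i j) = (\<Sum>i\<in>I. y i * w i j)"
      using fun_cong[OF eq, of j] by simp
    then show ?thesis
      by (simp add: left_diff_distrib sum_subtractf)
  qed (simp add: supp)
  then have "x i - y i = 0" if "i \<in> I" for i
    using indepD[OF assms(1), where x = "\<lambda>i. x i - y i"] that by blast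
  with x y show "x = y"
    by (intro PiE_ext) auto
qed

text \<open>
  Over a finite field dimension can be read off from cardinalities, so the comparison of dimensions
  and the criterion for spanning below only count the combinations of the family.
\<close>

lemma indep_card_le:
  fixes w :: "'i \<Rightarrow> 'j \<Rightarrow> 'a::{field,finite}"
  assumes "indep w I" "finite I" "finite J" "\<And>i j. i \<in> I \<Longrightarrow> j \<notin> J \<Longrightarrow> w i j = 0"
  shows "card I \<le> card J"
proof -
  have "card (I \<rightarrow>\<^sub>E (UNIV :: 'a set)) \<le> card (J \<rightarrow>\<^sub>E (UNIV :: 'a set))"
    using inj_on_combination[OF assms(1,4)] by (rule card_inj_on_le) (auto intro: finite_PiE assms)
  then have "CARD('a) ^ card I \<le> CARD('a) ^ card J"
    by (simp add: card_PiE assms)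
  moreover have "1 < CARD('a)"
    using card_mono[of "UNIV :: 'a set" "{0, 1}"] by simp
  ultimately show ?thesis
    by (simp add: power_increasing_iff)
qed

lemma indep_spanning:
  fixes w :: "'i \<Rightarrow> 'j \<Rightarrow> 'a::{field,finite}"
  assumes "indep w I" "finite I" "finite J" "\<And>i j. i \<in> I \<Longrightarrow> j \<notin> J \<Longrightarrow> w i j = 0"
    and "card J = card I" and y: "\<And>j. j \<notin> J \<Longrightarrow> y j = 0"
  obtains x where "\<And>j. (\<Sum>i\<in>I. x i * w i j) = y j"
proof -
  let ?f = "\<lambda>x. restrict (\<lambda>j. \<Sum>i\<in>I. x i * w i j) J"
  have "?f ` (I \<rightarrow>\<^sub>E UNIV) = (J \<rightarrow>\<^sub>E UNIV)"
  proof (rule card_subset_eq)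
    show "finite (J \<rightarrow>\<^sub>E (UNIV :: 'a set))"
      by (intro finite_PiE assms) auto
    show "?f ` (I \<rightarrow>\<^sub>E UNIV) \<subseteq> J \<rightarrow>\<^sub>E UNIV"
      by auto
    show "card (?f ` (I \<rightarrow>\<^sub>E UNIV)) = card (J \<rightarrow>\<^sub>E (UNIV :: 'a set))"
      by (simp add: card_image[OF inj_on_combination[OF assms(1,4)]] card_PiE assms)
  qed
  moreover have "restrict y J \<in> J \<rightarrow>\<^sub>E UNIV"
    by simp
  ultimately have "restrict y J \<in> ?f ` (I \<rightarrow>\<^sub>E UNIV)"
    by (simp only:)
  then obtain x where x: "?f x = restrict y J"
    by (elim imageE) (rule that, erule sym)
  have "(\<Sum>i\<in>I. x i * w i j) = y j" for j
    using fun_cong[OF x, of j] assms(4) y by (cases "j \<in> J") simp_all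
  then show ?thesis
    by (rule that)
qed

text \<open>
  This is the bound for the number of eigenvalues of an operator: for each bad \<open>c\<close> choose a nonzero
  \<open>v\<^sub>c\<close> with \<open>\<Sum>\<^sub>i v\<^sub>c i (a\<^sub>i + c b\<^sub>i) = 0\<close>.  Since the \<open>b\<^sub>i\<close> are independent, these behave like
  eigenvectors for distinct eigenvalues and are independent themselves.
\<close>

lemma card_dependent_pencil_le:
  fixes a b :: "'i \<Rightarrow> 'j \<Rightarrow> 'a::{field,finite}"
  assumes b: "indep b I" and I: "finite I"
  shows "card {c. \<not> indep (\<lambda>i j. a i j + c * b i j) I} \<le> card I"
proof -
  define L where "L = {c. \<not> indep (\<lambda>i j. a i j + c * b i j) I}"
  have "\<exists>x. (\<forall>j. (\<Sum>i\<in>I. x i * (a i j + c * b i j)) = 0) \<and> (\<exists>i\<in>I. x i \<noteq> 0)" if "c \<in> L" for c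
    using that unfolding L_def indep_def by blast
  then obtain v where v: "\<And>c j. c \<in> L \<Longrightarrow> (\<Sum>i\<in>I. v c i * (a i j + c * b i j)) = 0"
    and v0: "\<And>c. c \<in> L \<Longrightarrow> \<exists>i\<in>I. v c i \<noteq> 0"
    by metis
  have va: "(\<Sum>i\<in>I. v c i * a i j) = - c * (\<Sum>i\<in>I. v c i * b i j)" if "c \<in> L" for c j
  proof -
    have "(\<Sum>i\<in>I. v c i * a i j) + c * (\<Sum>i\<in>I. v c i * b i j) = 0"
      unfolding v[OF that, of j, symmetric] sum_distrib_left
      by (simp add: distrib_left sum.distrib mult.left_commute)
    then show ?thesis
      by (simp add: eq_neg_iff_add_eq_0)
  qed
  have key: "\<forall>c\<in>M. x c = 0"
    if "finite M" "M \<subseteq> L" "\<And>i. i \<in> I \<Longrightarrow> (\<Sum>c\<in>M. x c * v c i) = 0" for M x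
    using that
  proof (induction M arbitrary: x rule: finite_induct)
    case (insert e M)
    \<comment> \<open>On \<open>v\<^sub>c\<close> the family \<open>a\<close> gives the same as \<open>- c b\<close>, so evaluating a relation between the \<open>v\<^sub>c\<close> with \<open>a\<close>
      and cancelling \<open>b\<close> yields a relation with coefficients multiplied by \<open>c\<close>.\<close>
    have "(\<Sum>i\<in>I. (\<Sum>c\<in>insert e M. x c * c * v c i) * b i j) = 0" for j
    proof -
      have "(\<Sum>i\<in>I. (\<Sum>c\<in>insert e M. x c * c * v c i) * b i j)
          = (\<Sum>c\<in>insert e M. x c * (c * (\<Sum>i\<in>I. v c i * b i j)))"
        unfolding sum_distrib_left sum_distrib_right
        by (subst sum.swap) (simp add: mult_ac)
      also have "\<dots> = (\<Sum>c\<in>insert e M. x c * (- (\<Sum>i\<in>I. v c i * a i j)))"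
        using insert.prems(1) by (intro sum.cong refl) (simp add: va subset_eq del: ball_simps)
      also have "\<dots> = - (\<Sum>i\<in>I. (\<Sum>c\<in>insert e M. x c * v c i) * a i j)"
        unfolding sum_distrib_left sum_distrib_right mult_minus_right sum_negf
        by (subst sum.swap) (simp add: mult_ac)
      also have "\<dots> = 0"
        by (simp add: insert.prems(2) del: sum.insert)
      finally show ?thesis .
    qed
    then have eig: "(\<Sum>c\<in>insert e M. x c * c * v c i) = 0" if "i \<in> I" for i
      using indepD[OF b, of "\<lambda>i. \<Sum>c\<in>insert e M. x c * c * v c i"] that by blast
    \<comment> \<open>Subtracting \<open>e\<close> times the original relation removes the term with index \<open>e\<close>.\<close>
    have "(\<Sum>c\<in>M. x c * (c - e) * v c i) = 0" if i: "i \<in> I" for i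
    proof -
      have "(\<Sum>c\<in>M. x c * (c - e) * v c i) = (\<Sum>c\<in>insert e M. x c * (c - e) * v c i)"
        using insert.hyps by simp
      also have "\<dots> = (\<Sum>c\<in>insert e M. x c * c * v c i) - e * (\<Sum>c\<in>insert e M. x c * v c i)"
        by (simp only: sum_distrib_left sum_subtractf[symmetric]) (simp add: algebra_simps)
      finally show ?thesis
        using eig[OF i] insert.prems(2)[OF i] by simp
    qed
    then have "\<forall>c\<in>M. x c * (c - e) = 0"
      using insert.prems(1) by (intro insert.IH) auto
    then have M: "\<forall>c\<in>M. x c = 0"
      using insert.hyps by auto
    obtain i where i: "i \<in> I" "v e i \<noteq> 0"
      using v0[of e] insert.prems(1) by auto
    have "(\<Sum>c\<in>M. x c * v c i) = 0"
      using M by simp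
    then have "x e * v e i = 0"
      using insert.prems(2)[OF i(1)] insert.hyps by simp
    with M i show ?case
      by simp
  qed simp
  have "indep (\<lambda>c i. if i \<in> I then v c i else 0) L"
    unfolding indep_def
  proof (intro allI impI)
    fix x assume *: "\<forall>i. (\<Sum>c\<in>L. x c * (if i \<in> I then v c i else 0)) = 0"
    show "\<forall>c\<in>L. x c = 0"
    proof (rule key)
      show "(\<Sum>c\<in>L. x c * v c i) = 0" if "i \<in> I" for i
        using *[rule_format, of i] that by simp
    qed auto
  qed
  then have "card L \<le> card I"
    by (rule indep_card_le) (use I in auto)
  then show ?thesis
    by (simp add: L_def)
qed

section \<open>Counting along lines\<close>

text \<open>
  Double counting of the pairs \<open>(c, x)\<close> with \<open>P (\<tau> c x)\<close>: for fixed \<open>c\<close> the map \<open>\<tau> c\<close> permutes \<open>S\<close>.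
\<close>

lemma card_bad_translates_le:
  fixes \<tau> :: "'a::finite \<Rightarrow> 'x \<Rightarrow> 'x"
  assumes "finite S" and bij: "\<And>c. bij_betw (\<tau> c) S S"
    and le: "\<And>x. x \<in> S \<Longrightarrow> card {c. P (\<tau> c x)} \<le> D"
  shows "CARD('a) * card {x \<in> S. P x} \<le> card S * D"
proof -
  have "card {x \<in> S. P (\<tau> c x)} = card {x \<in> S. P x}" for c
  proof (rule bij_betw_same_card)
    show "bij_betw (\<tau> c) {x \<in> S. P (\<tau> c x)} {x \<in> S. P x}"
    proof (rule bij_betw_imageI)
      show "inj_on (\<tau> c) {x \<in> S. P (\<tau> c x)}"
        using bij_betw_imp_inj_on[OF bij] by (rule inj_on_subset) auto
      show "\<tau> c ` {x \<in> S. P (\<tau> c x)} = {x \<in> S. P x}"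
        using bij_betw_imp_surj_on[OF bij, of c] by auto
    qed
  qed
  then have "CARD('a) * card {x \<in> S. P x} = (\<Sum>c\<in>(UNIV :: 'a set). card {x \<in> S. P (\<tau> c x)})"
    by simp
  also have "\<dots> = (\<Sum>c\<in>(UNIV :: 'a set). \<Sum>x\<in>S. if P (\<tau> c x) then 1 else 0)"
    using \<open>finite S\<close> by (intro sum.cong refl) (simp add: sum.If_cases Int_def)
  also have "\<dots> = (\<Sum>x\<in>S. card {c. P (\<tau> c x)})"
    by (subst sum.swap) (simp add: sum.If_cases)
  also have "\<dots> \<le> card S * D"
    using sum_bounded_above[of S _ D] le by simp
  finally show ?thesis .
qed

section \<open>Polynomials of bounded degree\<close>

abbreviation keys :: "('b \<Rightarrow>\<^sub>0 'c::zero) \<Rightarrow> 'b set" where "keys \<equiv> Poly_Mapping.keys"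
abbreviation lookup :: "('b \<Rightarrow>\<^sub>0 'c::zero) \<Rightarrow> 'b \<Rightarrow> 'c" where "lookup \<equiv> Poly_Mapping.lookup"
abbreviation mon :: "monomial \<Rightarrow> 'a::zero_neq_one mpoly" where "mon m \<equiv> Poly_Mapping.single m 1"
abbreviation vpow :: "nat \<Rightarrow> nat \<Rightarrow> monomial" where "vpow v k \<equiv> Poly_Mapping.single v k"

text \<open>
  Unlike \<open>polys_upto\<close>, the following sets allow an arbitrary set of variables.
\<close>

definition monoms :: "nat set \<Rightarrow> nat \<Rightarrow> monomial set" where
  "monoms V e = {m. keys m \<subseteq> V \<and> mono_degree m \<le> e}"

definition polys :: "nat set \<Rightarrow> nat \<Rightarrow> 'a::zero mpoly set" where
  "polys V e = {f. keys f \<subseteq> monoms V e}"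

lemma keys_plus_nat: "keys (m + n) = keys m \<union> keys (n :: monomial)"
  by (auto simp: in_keys_iff lookup_add)

lemma mono_degree_eq:
  assumes "finite A" "keys m \<subseteq> A"
  shows "mono_degree m = (\<Sum>i\<in>A. lookup m i)"
  unfolding mono_degree_def using assms by (intro sum.mono_neutral_left) (auto simp: in_keys_iff)

lemma mono_degree_0 [simp]: "mono_degree 0 = 0"
  by (simp add: mono_degree_def)

lemma mono_degree_single [simp]: "mono_degree (Poly_Mapping.single i k) = k"
  by (simp add: mono_degree_def)

lemma mono_degree_add [simp]: "mono_degree (m + n) = mono_degree m + mono_degree n"
proof -
  have "finite (keys m \<union> keys n)" by simp
  then show ?thesis
    by (subst (1 2 3) mono_degree_eq[of "keys m \<union> keys n"])
      (auto simp: keys_plus_nat lookup_add sum.distrib)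
qed

lemma lookup_le_mono_degree: "lookup m i \<le> mono_degree m"
proof (cases "i \<in> keys m")
  case True
  then show ?thesis
    unfolding mono_degree_def by (intro member_le_sum) auto
qed (simp add: in_keys_iff)

lemma single_le_split:
  assumes "k \<le> lookup (m :: monomial) v"
  obtains n where "m = n + vpow v k"
proof
  show "m = (m - vpow v k) + vpow v k"
    using assms by (intro poly_mapping_eqI) (auto simp: lookup_add lookup_minus lookup_single when_def)
qed

lemma zero_in_monos [simp]: "0 \<in> monoms V e"
  by (simp add: monoms_def)

lemma monoms_add: "m \<in> monoms V a \<Longrightarrow> n \<in> monoms V b \<Longrightarrow> m + n \<in> monoms V (a + b)"
  by (auto simp: monoms_def keys_plus_nat)

lemma monoms_mono: "a \<le> b \<Longrightarrow> monoms V a \<subseteq> monoms V b"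
  by (auto simp: monoms_def)

lemma monoms_insert_subset:
  "monoms (insert v V) e \<subseteq> (\<Union>k\<in>{..e}. (\<lambda>m. m + vpow v (e - k)) ` monoms V k)"
proof
  fix m assume m: "m \<in> monoms (insert v V) e"
  define k where "k = lookup m v"
  obtain n where n: "m = n + vpow v k"
  proof (rule single_le_split)
    show "k \<le> lookup m v"
      by (simp add: k_def)
  qed
  have v: "lookup n v = 0"
    using k_def unfolding n by (simp add: lookup_add)
  have "i \<in> V" if "i \<in> keys n" for i
  proof -
    have "i \<noteq> v"
      using v that by (auto simp: in_keys_iff)
    moreover have "i \<in> insert v V"
      using m that unfolding n by (auto simp: monoms_def keys_plus_nat)
    ultimately show ?thesis
      by simp
  qed
  moreover have "mono_degree n + k \<le> e"
    using m unfolding n by (simp add: monoms_def)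
  ultimately show "m \<in> (\<Union>k\<in>{..e}. (\<lambda>m. m + vpow v (e - k)) ` monoms V k)"
    unfolding n by (intro UN_I[of "e - k"] image_eqI[of _ _ n]) (auto simp: monoms_def)
qed

text \<open>
  Induction on the variables: a monomial of degree at most \<open>e\<close> in which \<open>X\<^sub>v\<close> has the exponent \<open>e - k\<close>
  is determined by \<open>k\<close> and a monomial of degree at most \<open>k\<close> in the other variables, and the resulting
  binomial coefficients sum up along a diagonal of Pascal's triangle.
\<close>

lemma finite_monoms_card_le:
  assumes "finite V"
  shows "finite (monoms V e) \<and> card (monoms V e) \<le> (card V + e) choose e"
  using assms
proof (induction V arbitrary: e rule: finite_induct)
  case empty
  have "monoms {} e = {0}"
    by (auto simp: monoms_def)
  then show ?case
    by simp
next
  case (insert v V)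
  let ?U = "\<Union>k\<in>{..e}. (\<lambda>m. m + vpow v (e - k)) ` monoms V k"
  have fin: "finite ?U"
    using insert.IH by blast
  have "card (monoms (insert v V) e) \<le> card ?U"
    using fin monoms_insert_subset by (rule card_mono)
  also have "\<dots> \<le> (\<Sum>k\<le>e. card ((\<lambda>m. m + vpow v (e - k)) ` monoms V k))"
    by (rule card_UN_le) simp
  also have "\<dots> \<le> (\<Sum>k\<le>e. (card V + k) choose k)"
  proof (rule sum_mono)
    fix k
    show "card ((\<lambda>m. m + vpow v (e - k)) ` monoms V k) \<le> (card V + k) choose k"
      using insert.IH[of k] card_image_le[of "monoms V k"] le_trans by blast
  qed
  also have "\<dots> = (card (insert v V) + e) choose e"
    using insert.hyps by (simp add: sum_choose_lower)
  finally show ?case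
    using finite_subset[OF monoms_insert_subset fin] by simp
qed

lemmas finite_monoms = finite_monoms_card_le[THEN conjunct1]

lemma keys_Const [simp]: "keys (Const c) = (if c = 0 then {} else {0})"
  by (simp add: Const_def)

lemma Const_0 [simp]: "Const 0 = 0"
  by (simp add: Const_def)

lemma Const_1 [simp]: "Const 1 = 1"
  by (simp add: Const_def)

lemma Const_add: "Const (a + b) = Const a + Const (b :: 'a::comm_ring_1)"
  by (simp add: Const_def single_add)

lemma Const_diff: "Const (a - b) = Const a - Const (b :: 'a::comm_ring_1)"
  by (simp add: Const_def single_diff)

lemma Const_mult: "Const (a * b) = Const a * Const (b :: 'a::comm_ring_1)"
  by (simp add: Const_def mult_single)

lemma Const_power: "Const (a ^ n) = Const (a :: 'a::comm_ring_1) ^ n"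
  by (induction n) (simp_all add: Const_mult)

lemma lookup_Const_mult [simp]: "lookup (Const c * f) m = c * lookup (f :: 'a::comm_ring_1 mpoly) m"
  by (simp add: Const_def mult_map_scale_conv_mult[symmetric] map.rep_eq when_def)

lemma mon_mult: "mon (m + n) = mon m * (mon n :: 'a::comm_ring_1 mpoly)"
  by (simp add: mult_single)

lemma Var_power: "Var v ^ k = (mon (vpow v k) :: 'a::comm_ring_1 mpoly)"
  by (induction k) (simp_all add: Var_def mult_single single_add[symmetric])

lemma mon_prod: "(\<Prod>i\<in>keys m. Var i ^ lookup m i) = (mon m :: 'a::comm_ring_1 mpoly)"
proof -
  have "(\<Prod>i\<in>A. Var i ^ lookup m i) = (mon (\<Sum>i\<in>A. vpow i (lookup m i)) :: 'a mpoly)" if "finite A" for A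
    using that by (induction A rule: finite_induct) (simp_all add: Var_power mult_single)
  moreover have "(\<Sum>i\<in>keys m. vpow i (lookup m i)) = m"
    by (rule poly_mapping_eqI) (auto simp: lookup_sum lookup_single when_def in_keys_iff)
  ultimately show ?thesis
    by simp
qed

lemma poly_expand:
  fixes f :: "'a::comm_ring_1 mpoly"
  assumes "finite M" "keys f \<subseteq> M"
  shows "f = (\<Sum>m\<in>M. Const (lookup f m) * mon m)"
proof (rule poly_mapping_eqI)
  fix k
  have "lookup (\<Sum>m\<in>M. Const (lookup f m) * mon m) k = (\<Sum>m\<in>M. if m = k then lookup f m else 0)"
    unfolding lookup_sum by (intro sum.cong) (auto simp: lookup_single)
  also have "\<dots> = lookup f k"
    using assms by (auto simp: in_keys_iff)
  finally show "lookup f k = lookup (\<Sum>m\<in>M. Const (lookup f m) * mon m) k"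
    by simp
qed

lemma combination_eq:
  "(\<Sum>m\<in>M. Const (x m) * f m) = g \<longleftrightarrow> (\<forall>k. (\<Sum>m\<in>M. x m * lookup (f m) k) = lookup (g :: 'a::comm_ring_1 mpoly) k)"
  by (simp add: poly_mapping_eq_iff fun_eq_iff lookup_sum)

lemma polys_0 [simp]: "0 \<in> polys V e"
  by (simp add: polys_def)

lemma polys_Const [simp]: "Const c \<in> polys V e"
  by (simp add: polys_def)

lemma polys_1 [simp]: "1 \<in> polys V e"
  by (simp add: polys_def)

lemma mon_in_polys [simp]: "(mon m :: 'a::zero_neq_one mpoly) \<in> polys V e \<longleftrightarrow> m \<in> monoms V e"
  by (simp add: polys_def)

lemma polys_add: "f \<in> polys V e \<Longrightarrow> g \<in> polys V e \<Longrightarrow> f + g \<in> polys V e"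
  using Poly_Mapping.keys_add[of f g] by (auto simp: polys_def)

lemma polys_uminus: "(f :: 'a::comm_ring_1 mpoly) \<in> polys V e \<Longrightarrow> - f \<in> polys V e"
  by (auto simp: polys_def)

lemma polys_mult:
  fixes f :: "'a::comm_ring_1 mpoly"
  assumes "f \<in> polys V a" "g \<in> polys V b"
  shows "f * g \<in> polys V (a + b)"
  unfolding polys_def
proof (clarify)
  fix m assume "m \<in> keys (f * g)"
  then obtain u v where "m = u + v" "u \<in> keys f" "v \<in> keys g"
    using keys_mult[of f g] by blast
  with assms show "m \<in> monoms V (a + b)"
    by (auto simp: polys_def intro!: monoms_add)
qed

lemma polys_Const_mult: "(f :: 'a::comm_ring_1 mpoly) \<in> polys V e \<Longrightarrow> Const c * f \<in> polys V e"
  using polys_mult[of "Const c" V 0 f e] by simp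

lemma polys_sum: "(\<And>i. i \<in> I \<Longrightarrow> f i \<in> polys V e) \<Longrightarrow> sum f I \<in> polys V e"
  by (induction I rule: infinite_finite_induct) (auto intro: polys_add)

lemma polys_power: "(f :: 'a::comm_ring_1 mpoly) \<in> polys V e \<Longrightarrow> f ^ n \<in> polys V (n * e)"
  by (induction n) (auto intro: polys_mult)

lemma polys_prod:
  "(\<And>i. i \<in> A \<Longrightarrow> (f i :: 'a::comm_ring_1 mpoly) \<in> polys V (e i)) \<Longrightarrow> prod f A \<in> polys V (sum e A)"
  by (induction A rule: infinite_finite_induct) (auto intro!: polys_mult)

lemma polys_mono: "a \<le> b \<Longrightarrow> polys V a \<subseteq> polys V b"
  using monoms_mono[of a b V] by (auto simp: polys_def)

lemma finite_polys:
  assumes "finite V"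
  shows "finite (polys V e :: 'a::{comm_ring_1,finite} mpoly set)"
proof (rule finite_imageD)
  show "inj_on lookup (polys V e :: 'a mpoly set)"
    by (simp add: inj_on_def)
  have "lookup ` (polys V e :: 'a mpoly set) \<subseteq>
      {f. \<forall>m. (m \<in> monoms V e \<longrightarrow> f m \<in> UNIV) \<and> (m \<notin> monoms V e \<longrightarrow> f m = 0)}"
    by (auto simp: polys_def in_keys_iff)
  then show "finite (lookup ` (polys V e :: 'a mpoly set))"
    by (rule finite_subset) (rule finite_set_of_finite_funs[OF finite_monoms[OF assms] finite])
qed

lemma vars_subset_iff: "vars f \<subseteq> V \<longleftrightarrow> (\<exists>e. f \<in> polys V e)"
proof
  assume V: "vars f \<subseteq> V"
  have "mono_degree m \<le> (\<Sum>m\<in>keys f. mono_degree m)" if "m \<in> keys f" for m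
    using that by (intro member_le_sum) auto
  with V show "\<exists>e. f \<in> polys V e"
    by (auto simp: polys_def monoms_def vars_def)
qed (auto simp: polys_def monoms_def vars_def)

lemma polys_vars: "f \<in> polys V e \<Longrightarrow> vars f \<subseteq> V"
  by (auto simp: vars_subset_iff)

lemma vars_add_subset: "vars f \<subseteq> V \<Longrightarrow> vars g \<subseteq> V \<Longrightarrow> vars (f + g :: 'a::comm_ring_1 mpoly) \<subseteq> V"
  using vars_add[of f g] by blast

lemma vars_diff_subset: "vars f \<subseteq> V \<Longrightarrow> vars g \<subseteq> V \<Longrightarrow> vars (f - g :: 'a::comm_ring_1 mpoly) \<subseteq> V"
  using vars_add[of f "- g"] by simp blast

lemma vars_mult_subset: "vars f \<subseteq> V \<Longrightarrow> vars g \<subseteq> V \<Longrightarrow> vars (f * g :: 'a::comm_ring_1 mpoly) \<subseteq> V"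
  using vars_mult[of f g] by blast

lemma vars_power_subset: "vars f \<subseteq> V \<Longrightarrow> vars (f ^ n :: 'a::comm_ring_1 mpoly) \<subseteq> V"
  by (induction n) (simp_all add: vars_mult_subset)

lemma vars_sum_subset:
  "(\<And>i. i \<in> I \<Longrightarrow> vars (f i) \<subseteq> V) \<Longrightarrow> vars (sum f I :: 'a::comm_ring_1 mpoly) \<subseteq> V"
  by (induction I rule: infinite_finite_induct) (simp_all add: vars_add_subset)

lemma vars_mon: "vars (mon m :: 'a::comm_ring_1 mpoly) = keys m"
  by (simp add: vars_def)

lemma vars_Const [simp]: "vars (Const c) = {}"
  by (simp add: vars_def)

lemma vars_Var [simp]: "vars (Var v :: 'a::comm_ring_1 mpoly) = {v}"
  by (simp add: vars_def Var_def)

lemmas vars_subset_intros =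
  vars_add_subset vars_diff_subset vars_mult_subset vars_power_subset vars_sum_subset

lemma polys_upto_eq: "polys_upto r d = polys {1..r} d"
  unfolding polys_upto_def polys_def monoms_def vars_def poly_ring_def by auto

section \<open>Linear extension\<close>

text \<open>
  Every linear map that occurs below is determined by its values on monomials; for instance partial
  evaluation, partial derivatives and the map \<open>adic\<close>.
\<close>

definition lin :: "(monomial \<Rightarrow> 'a mpoly) \<Rightarrow> 'a::comm_ring_1 mpoly \<Rightarrow> 'a mpoly" where
  "lin \<phi> f = (\<Sum>m\<in>keys f. Const (lookup f m) * \<phi> m)"

lemma lin_eq:
  assumes "finite M" "keys f \<subseteq> M"
  shows "lin \<phi> f = (\<Sum>m\<in>M. Const (lookup f m) * \<phi> m)"
  unfolding lin_def using assms by (intro sum.mono_neutral_left) (auto simp: in_keys_iff)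

lemma lin_add: "lin \<phi> (f + g) = lin \<phi> f + lin \<phi> g"
proof -
  have "finite (keys f \<union> keys g)" by simp
  then show ?thesis
    by (subst (1 2 3) lin_eq[of "keys f \<union> keys g"])
      (use Poly_Mapping.keys_add[of f g] in
        \<open>auto simp: lookup_add Const_add distrib_right sum.distrib\<close>)
qed

lemma lin_0 [simp]: "lin \<phi> 0 = 0"
  by (simp add: lin_def)

lemma lin_mon [simp]: "lin \<phi> (mon m) = \<phi> m"
  by (simp add: lin_def)

lemma lin_Const_mult: "lin \<phi> (Const c * f) = Const c * lin \<phi> f"
proof -
  have "keys (Const c * f) \<subseteq> keys f"
    by (auto simp: in_keys_iff)
  then show ?thesis
    by (subst lin_eq[of "keys f"]) (simp_all add: lin_def Const_mult sum_distrib_left mult.assoc)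
qed

lemma lin_Const: "lin \<phi> (Const c) = Const c * \<phi> 0"
  using lin_Const_mult[of \<phi> c 1] lin_mon[of \<phi> 0] by simp

lemma lin_sum: "lin \<phi> (sum f I) = (\<Sum>i\<in>I. lin \<phi> (f i))"
  by (induction I rule: infinite_finite_induct) (simp_all add: lin_add)

lemma lin_diff: "lin \<phi> (f - g) = lin \<phi> f - lin \<phi> g"
  using lin_add[of \<phi> "f - g" g] by simp

lemma lin_cong: "(\<And>m. m \<in> keys f \<Longrightarrow> \<phi> m = \<psi> m) \<Longrightarrow> lin \<phi> f = lin \<psi> f"
  by (simp add: lin_def)

lemma lin_id [simp]: "lin mon f = f"
  using poly_expand[of "keys f" f] by (simp add: lin_def)

lemma lin_mult_mon: "lin \<phi> (mon n * f) = lin (\<lambda>m. \<phi> (n + m)) f"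
proof -
  have "mon n * f = (\<Sum>m\<in>keys f. Const (lookup f m) * mon (n + m))"
    by (subst poly_expand[of "keys f" f]) (simp_all add: sum_distrib_left mon_mult mult_ac)
  then show ?thesis
    by (simp add: lin_sum lin_Const_mult) (simp add: lin_def)
qed

lemma lin_mult: "lin (\<lambda>m. g * \<phi> m) f = g * lin \<phi> f"
  by (simp add: lin_def sum_distrib_left mult_ac)

lemma lin_in_polys:
  assumes "\<And>m. m \<in> keys f \<Longrightarrow> \<phi> m \<in> polys V e"
  shows "lin \<phi> f \<in> polys V e"
  unfolding lin_def using assms by (intro polys_sum polys_Const_mult)

lemma lookup_mon_mult [simp]: "lookup (mon n * f) (n + m) = lookup (f :: 'a::comm_ring_1 mpoly) m"
proof -
  have "lookup (mon n * f) (n + m) = lookup (lin (\<lambda>k. mon (n + k)) f) (n + m)"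
    using lin_mult_mon[of mon n f] by simp
  also have "\<dots> = (\<Sum>k\<in>keys f. if k = m then lookup f k else 0)"
    unfolding lin_def lookup_sum by (intro sum.cong) (auto simp: lookup_single)
  also have "\<dots> = lookup f m"
    by (auto simp: in_keys_iff)
  finally show ?thesis .
qed

lemma keys_mon_mult: "keys (mon n * f) \<subseteq> (\<lambda>m. n + m) ` keys (f :: 'a::comm_ring_1 mpoly)"
  using keys_mult[of "mon n" f] by auto

section \<open>The module structure given by a rewriting system\<close>

definition reduced :: "nat set \<Rightarrow> nat \<Rightarrow> monomial \<Rightarrow> bool" where
  "reduced V d m \<longleftrightarrow> (\<forall>v\<in>V. lookup m v < d)"

text \<open>
  The variable \<open>v\<close> for which a factor \<open>X\<^sub>v\<^sup>d\<close> of the monomial is replaced by \<open>G\<^sub>v\<close>.  Any choice works, as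
  long as it depends on the monomial only.
\<close>

definition pivot :: "nat set \<Rightarrow> nat \<Rightarrow> monomial \<Rightarrow> nat" where
  "pivot V d m = (SOME v. v \<in> V \<and> d \<le> lookup m v)"

text \<open>
  These are the rows of a Macaulay matrix of the system \<open>G\<close>, completed by the reduced monomials to a
  square matrix.
\<close>

definition rewrite_row :: "nat set \<Rightarrow> nat \<Rightarrow> (nat \<Rightarrow> 'a::comm_ring_1 mpoly) \<Rightarrow> monomial \<Rightarrow> 'a mpoly" where
  "rewrite_row V d G m = (if reduced V d m then mon m
     else mon (m - vpow (pivot V d m) d) * G (pivot V d m))"

text \<open>
  The expansion of a polynomial in these products is its \<open>G\<close>-adic expansion; for \<open>G\<^sub>v = X\<^sub>v\<^sup>d\<close> the
  product is \<open>X\<^sup>m\<close> itself.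
\<close>

definition adic_mono :: "nat set \<Rightarrow> nat \<Rightarrow> (nat \<Rightarrow> 'a::comm_ring_1 mpoly) \<Rightarrow> monomial \<Rightarrow> 'a mpoly" where
  "adic_mono V d G m = mon (Poly_Mapping.map (\<lambda>k. k mod d) m) * (\<Prod>v\<in>V. G v ^ (lookup m v div d))"

lemma pivot_split:
  assumes "\<not> reduced V d m"
  shows "pivot V d m \<in> V" "m = (m - vpow (pivot V d m) d) + vpow (pivot V d m) d"
proof -
  have "\<exists>v. v \<in> V \<and> d \<le> lookup m v"
    using assms by (auto simp: reduced_def not_less)
  from someI_ex[OF this] have v: "pivot V d m \<in> V" "d \<le> lookup m (pivot V d m)"
    by (auto simp: pivot_def)
  show "pivot V d m \<in> V"
    by (fact v)
  show "m = (m - vpow (pivot V d m) d) + vpow (pivot V d m) d"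
    using v(2) by (intro poly_mapping_eqI) (auto simp: lookup_add lookup_minus lookup_single when_def)
qed

lemma pivot_cases:
  assumes "m \<in> monoms V e"
  obtains "reduced V d m"
  | n where "\<not> reduced V d m" "pivot V d m \<in> V" "m = n + vpow (pivot V d m) d"
      "n = m - vpow (pivot V d m) d" "d \<le> e" "n \<in> monoms V (e - d)"
proof (cases "reduced V d m")
  case False
  define n where "n = m - vpow (pivot V d m) d"
  have m: "m = n + vpow (pivot V d m) d"
    using pivot_split(2)[OF False] by (simp add: n_def)
  have "n + vpow (pivot V d m) d \<in> monoms V e"
    using assms m by simp
  then have "d \<le> e" "n \<in> monoms V (e - d)"
    by (auto simp: monoms_def keys_plus_nat)
  then show ?thesis
    using that(2)[OF False pivot_split(1)[OF False] m n_def] by blast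
qed (use that in blast)

lemma adic_mono_shift:
  assumes "finite V" "v \<in> V" "0 < d"
  shows "adic_mono V d G (m + vpow v d) = G v * adic_mono V d G m"
proof -
  have "Poly_Mapping.map (\<lambda>k. k mod d) (m + vpow v d) = Poly_Mapping.map (\<lambda>k. k mod d) m"
    by (rule poly_mapping_eqI) (auto simp: map.rep_eq lookup_add lookup_single when_def)
  moreover have "(\<Prod>u\<in>V. G u ^ (lookup (m + vpow v d) u div d))
      = G v * (\<Prod>u\<in>V. G u ^ (lookup m u div d))"
  proof -
    have "(\<Prod>u\<in>V - {v}. G u ^ (lookup (m + vpow v d) u div d)) = (\<Prod>u\<in>V - {v}. G u ^ (lookup m u div d))"
      by (intro prod.cong refl) (auto simp: lookup_add lookup_single)
    then show ?thesis
      using assms by (simp add: prod.remove[of V v] lookup_add mult.assoc)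
  qed
  ultimately show ?thesis
    by (simp add: adic_mono_def mult_ac)
qed

lemma adic_mono_reduced:
  assumes "reduced V d m" "keys m \<subseteq> V"
  shows "adic_mono V d G m = mon m"
proof -
  have "lookup m v mod d = lookup m v" for v
    using assms unfolding reduced_def by (metis in_keys_iff subsetD mod_less mod_0)
  then have "Poly_Mapping.map (\<lambda>k. k mod d) m = m"
    by (intro poly_mapping_eqI) (simp add: map.rep_eq when_def)
  moreover have "(\<Prod>v\<in>V. G v ^ (lookup m v div d)) = 1"
    using assms(1) by (intro prod.neutral) (auto simp: reduced_def)
  ultimately show ?thesis
    by (simp add: adic_mono_def)
qed

lemma reduced_degree_le:
  assumes "finite V" "reduced V d m" "keys m \<subseteq> V"
  shows "mono_degree m \<le> card V * (d - 1)"
proof -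
  have "(\<Sum>v\<in>V. lookup m v) \<le> (\<Sum>v\<in>V. d - 1)"
    using assms(2) by (intro sum_mono) (auto simp: reduced_def)
  then show ?thesis
    by (simp add: mono_degree_eq[OF assms(1,3)])
qed

text \<open>
  There is one polynomial for each variable, and the variables serve as its index.
\<close>

locale poly_system =
  fixes V :: "nat set" and d :: nat and G :: "nat \<Rightarrow> 'a::{field,finite} mpoly"
  assumes finite_V [simp]: "finite V" and d_pos: "0 < d"
    and G_polys: "v \<in> V \<Longrightarrow> G v \<in> polys V d"
begin

abbreviation adic :: "'a mpoly \<Rightarrow> 'a mpoly" where
  "adic \<equiv> lin (adic_mono V d G)"

text \<open>
  The reason for introducing \<open>adic\<close>: it carries the module structure in which \<open>y\<^sub>v\<close> acts as \<open>X\<^sub>v\<^sup>d\<close> to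
  the one in which \<open>y\<^sub>v\<close> acts as \<open>G\<^sub>v\<close>.
\<close>

lemma adic_shift: "v \<in> V \<Longrightarrow> adic (mon (vpow v d) * f) = G v * adic f"
  by (simp add: lin_mult_mon add.commute[of "vpow v d"] adic_mono_shift d_pos lin_mult)

lemma rewrite_row_polys:
  assumes "m \<in> monoms V e"
  shows "rewrite_row V d G m \<in> polys V e"
  using assms
proof (cases rule: pivot_cases[where d = d])
  case 1
  with assms show ?thesis
    by (simp add: rewrite_row_def)
next
  case (2 n)
  then have "mon n * G (pivot V d m) \<in> polys V (e - d + d)"
    by (intro polys_mult G_polys) simp_all
  with 2 show ?thesis
    by (simp add: rewrite_row_def)
qed

lemma adic_mono_polys:
  assumes "m \<in> monoms V e"
  shows "adic_mono V d G m \<in> polys V e"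
  using assms
proof (induction e arbitrary: m rule: less_induct)
  case (less e)
  from less.prems show ?case
  proof (cases rule: pivot_cases[where d = d])
    case 1
    with less.prems show ?thesis
      by (subst adic_mono_reduced) (auto simp: monoms_def)
  next
    case (2 n)
    then have "G (pivot V d m) * adic_mono V d G n \<in> polys V (d + (e - d))"
      using d_pos by (intro polys_mult G_polys less.IH) auto
    moreover have "adic_mono V d G m = G (pivot V d m) * adic_mono V d G n"
      by (subst 2(3)) (simp add: adic_mono_shift 2(2) d_pos)
    ultimately show ?thesis
      using 2 by simp
  qed
qed

lemma adic_polys: "f \<in> polys V e \<Longrightarrow> adic f \<in> polys V e"
  by (intro lin_in_polys adic_mono_polys) (auto simp: polys_def)

lemma adic_vars: "vars f \<subseteq> V \<Longrightarrow> vars (adic f) \<subseteq> V"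
  unfolding vars_subset_iff using adic_polys by blast

lemma adic_reduced: "(\<And>m. m \<in> keys f \<Longrightarrow> reduced V d m \<and> keys m \<subseteq> V) \<Longrightarrow> adic f = f"
  using lin_cong[of f "adic_mono V d G" mon] adic_mono_reduced[of V d _ G] by simp

lemma adic_1 [simp]: "adic 1 = 1"
  by (rule adic_reduced) (use d_pos in \<open>auto simp: reduced_def\<close>)

definition adic_image :: "nat \<Rightarrow> 'a mpoly set" where
  "adic_image e = adic ` polys V e"

lemma adic_image_lin: "(\<And>m. m \<in> keys f \<Longrightarrow> \<phi> m \<in> adic_image e) \<Longrightarrow> lin \<phi> f \<in> adic_image e"
proof -
  assume "\<And>m. m \<in> keys f \<Longrightarrow> \<phi> m \<in> adic_image e"
  then obtain g where g: "\<And>m. m \<in> keys f \<Longrightarrow> g m \<in> polys V e \<and> \<phi> m = adic (g m)"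
    unfolding adic_image_def image_iff Bex_def by metis
  then have "lin \<phi> f = lin (\<lambda>m. adic (g m)) f"
    by (intro lin_cong) simp
  also have "\<dots> = adic (lin g f)"
    by (simp add: lin_def[of _ f] lin_sum lin_Const_mult)
  finally show ?thesis
    unfolding adic_image_def using g by (intro image_eqI[OF _ lin_in_polys]) auto
qed

lemma adic_image_mono: "a \<le> b \<Longrightarrow> adic_image a \<subseteq> adic_image b"
  unfolding adic_image_def using polys_mono by blast

lemma adic_image_shift:
  assumes "v \<in> V" "d \<le> e" "f \<in> adic_image (e - d)"
  shows "G v * f \<in> adic_image e"
proof -
  obtain g where g: "g \<in> polys V (e - d)" "f = adic g"
    using assms(3) by (auto simp: adic_image_def)
  have "mon (vpow v d) * g \<in> polys V (d + (e - d))"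
    using g assms by (intro polys_mult) (simp_all add: monoms_def)
  moreover have "G v * f = adic (mon (vpow v d) * g)"
    by (simp add: adic_shift assms g)
  ultimately show ?thesis
    using assms(2) by (simp add: adic_image_def)
qed

end

text \<open>
  A reduced monomial has degree at most \<open>card V * (d - 1)\<close>, so \<open>t\<close> is large enough for all monomials
  of degree \<open>t\<close> to be rewritten.  This bounded amount of information determines what happens in all
  higher degrees.
\<close>

locale rewriting_system = poly_system V d G
  for V d and G :: "nat \<Rightarrow> 'a::{field,finite} mpoly" +
  fixes t :: nat
  assumes t: "card V * (d - 1) + 1 \<le> t"
    and indep: "indep (\<lambda>m. lookup (rewrite_row V d G m)) (monoms V t)"
begin

text \<open>
  Induction on the degree \<open>e\<close>.  For \<open>e \<le> t\<close> the rewriting rows in degree at most \<open>e\<close> are independent,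
  hence span, and each of them is a reduced monomial or a multiple of some \<open>G\<^sub>v\<close> by a polynomial of
  smaller degree.  For \<open>e > t\<close> write a monomial of degree \<open>e\<close> as \<open>X\<^sub>u n\<close>, expand \<open>n\<close> by induction, and
  multiply the terms of the expansion by \<open>X\<^sub>u\<close>: a reduced term stays in degree at most \<open>t\<close>, and in any
  other term \<open>X\<^sub>u\<close> can be absorbed into the cofactor of some \<open>G\<^sub>v\<close>.
\<close>

lemma adic_surj: "f \<in> polys V e \<Longrightarrow> f \<in> adic_image e"
proof (induction e arbitrary: f rule: less_induct)
  case (less e)
  \<comment> \<open>The cofactor of \<open>G\<^sub>v\<close> in a row has degree at most \<open>e - d\<close>, where the induction hypothesis applies.\<close>
  have small: "rewrite_row V d G m \<in> adic_image e" if m: "m \<in> monoms V e" for m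
    using m
  proof (cases rule: pivot_cases[where d = d])
    case 1
    then have "rewrite_row V d G m = adic (mon m)"
      using m by (simp add: rewrite_row_def adic_mono_reduced monoms_def)
    with m show ?thesis
      unfolding adic_image_def by (intro image_eqI[of _ _ "mon m"]) simp_all
  next
    case (2 n)
    then have "mon n \<in> adic_image (e - d)"
      using d_pos by (intro less.IH) auto
    then have "G (pivot V d m) * mon n \<in> adic_image e"
      by (rule adic_image_shift[OF 2(2) 2(5)])
    then show ?thesis
      using 2 by (simp add: rewrite_row_def mult.commute)
  qed
  show ?case
  proof (cases "e \<le> t")
    case True
    have "indep (\<lambda>m. lookup (rewrite_row V d G m)) (monoms V e)"
      by (rule indep_subset[OF indep monoms_mono[OF True]]) (simp add: finite_monoms)
    then obtain x where x: "\<And>j. (\<Sum>m\<in>monoms V e. x m * lookup (rewrite_row V d G m) j) = lookup f j"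
    proof (rule indep_spanning)
      show "lookup (rewrite_row V d G m) j = 0" if "m \<in> monoms V e" "j \<notin> monoms V e" for m j
        using rewrite_row_polys[OF that(1)] that(2) by (auto simp: polys_def in_keys_iff)
      show "lookup f j = 0" if "j \<notin> monoms V e" for j
        using less.prems that by (auto simp: polys_def in_keys_iff)
    qed (auto simp: finite_monoms)
    define g where "g = (\<Sum>m\<in>monoms V e. Const (x m) * mon m)"
    have g: "keys g \<subseteq> monoms V e"
      using polys_sum[of "monoms V e" "\<lambda>m. Const (x m) * mon m" V e]
      by (simp add: g_def polys_Const_mult polys_def[symmetric])
        (simp add: polys_def)
    have "f = (\<Sum>m\<in>monoms V e. Const (x m) * rewrite_row V d G m)"
      by (rule poly_mapping_eqI) (simp add: lookup_sum x)
    also have "\<dots> = lin (rewrite_row V d G) g"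
      by (simp add: g_def lin_sum lin_Const_mult)
    also have "\<dots> \<in> adic_image e"
      using g small by (intro adic_image_lin) auto
    finally show ?thesis .
  next
    case False
    have shift: "mon (vpow u 1) * adic_mono V d G k \<in> adic_image e" if u: "u \<in> V" and k: "k \<in> monoms V (e - 1)" for u k
      using k
    proof (cases rule: pivot_cases[where d = d])
      case 1
      \<comment> \<open>Here \<open>t\<close> must exceed the largest degree of a reduced monomial.\<close>
      have "mono_degree k + 1 \<le> t"
        using reduced_degree_le[OF finite_V 1] k t by (simp add: monoms_def)
      then have "mon (vpow u 1 + k) \<in> adic_image (e - 1)"
        using False u k by (intro less.IH) (auto simp: monoms_def keys_plus_nat)
      then have "mon (vpow u 1) * mon k \<in> adic_image e"
        using adic_image_mono[of "e - 1" e] by (auto simp: mon_mult)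
      with 1 k show ?thesis
        by (simp add: adic_mono_reduced monoms_def)
    next
      case (2 n)
      have "mon (vpow u 1) * adic_mono V d G n \<in> polys V (1 + (e - 1 - d))"
        using u 2 by (intro polys_mult adic_mono_polys) (auto simp: monoms_def)
      \<comment> \<open>Subtraction does not truncate here because \<open>d \<le> e - 1\<close>.\<close>
      moreover have "1 + (e - 1 - d) = e - d"
        using 2(5) False t by simp
      ultimately have "mon (vpow u 1) * adic_mono V d G n \<in> adic_image (e - d)"
        using d_pos 2(5) False t by (intro less.IH) auto
      then have "G (pivot V d k) * (mon (vpow u 1) * adic_mono V d G n) \<in> adic_image e"
        using 2 by (intro adic_image_shift) auto
      moreover have "adic_mono V d G k = G (pivot V d k) * adic_mono V d G n"
        by (subst 2(3)) (simp add: adic_mono_shift 2(2) d_pos)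
      ultimately show ?thesis
        by (simp add: mult_ac)
    qed
    have "mon m \<in> adic_image e" if m: "m \<in> monoms V e" for m
    proof (cases "mono_degree m < e")
      case True
      then have "mon m \<in> adic_image (mono_degree m)"
        using m by (intro less.IH) (auto simp: monoms_def)
      with True show ?thesis
        using adic_image_mono[of "mono_degree m" e] by auto
    next
      case nless: False
      then have "m \<noteq> 0"
        using False t by auto
      then obtain u where u: "u \<in> keys m"
        by (metis keys_eq_empty ex_in_conv)
      then have "1 \<le> lookup m u"
        by (simp add: in_keys_iff Suc_le_eq)
      then obtain n where n: "m = n + vpow u 1"
        by (rule single_le_split)
      have "mon n \<in> adic_image (e - 1)"
        using m False unfolding n by (intro less.IH) (auto simp: monoms_def keys_plus_nat)
      then obtain g where g: "g \<in> polys V (e - 1)" "mon n = adic g"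
        by (auto simp: adic_image_def)
      have "(mon m :: 'a mpoly) = mon (vpow u 1) * adic g"
        by (simp add: n mon_mult g(2)[symmetric] mult.commute del: One_nat_def)
      also have "\<dots> = lin (\<lambda>k. mon (vpow u 1) * adic_mono V d G k) g"
        by (simp add: lin_mult)
      also have "\<dots> \<in> adic_image e"
        using g(1) u m by (intro adic_image_lin shift) (auto simp: polys_def monoms_def)
      finally show ?thesis .
    qed
    then have "lin mon f \<in> adic_image e"
      using less.prems by (intro adic_image_lin) (auto simp: polys_def)
    then show ?thesis
      by simp
  qed
qed

lemma adic_onto:
  assumes "vars f \<subseteq> V"
  obtains g where "vars g \<subseteq> V" "adic g = f"
proof -
  obtain e where "f \<in> polys V e"
    using assms by (auto simp: vars_subset_iff)
  from adic_surj[OF this] obtain g where "g \<in> polys V e" "adic g = f"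
    by (auto simp: adic_image_def)
  then show ?thesis
    using that polys_vars by blast
qed

text \<open>
  In each degree \<open>adic\<close> is a surjective map from a finite set to itself.
\<close>

lemma adic_eq_0:
  assumes "vars f \<subseteq> V" "adic f = 0"
  shows "f = 0"
proof -
  obtain e where f: "f \<in> polys V e"
    using assms(1) by (auto simp: vars_subset_iff)
  have "polys V e \<subseteq> adic ` polys V e"
    using adic_surj by (auto simp: adic_image_def)
  then have "inj_on adic (polys V e)"
    by (rule finite_surj_inj[OF finite_polys[OF finite_V]])
  then show ?thesis
    using f assms(2) by (auto dest: inj_onD[of _ _ f 0])
qed

end

section \<open>Ideals\<close>

text \<open>
  The ideals of \<open>poly_ring V\<close>, stated with the operations of the type; see \<open>ideal_poly_ring_iff\<close>.
\<close>

definition is_ideal :: "nat set \<Rightarrow> 'a::comm_ring_1 mpoly set \<Rightarrow> bool" where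
  "is_ideal V I \<longleftrightarrow> 0 \<in> I \<and> (\<forall>f\<in>I. vars f \<subseteq> V) \<and> (\<forall>f\<in>I. \<forall>g\<in>I. f + g \<in> I) \<and>
     (\<forall>f\<in>I. \<forall>g. vars g \<subseteq> V \<longrightarrow> g * f \<in> I)"

text \<open>
  For finite \<open>W\<close> this is the ideal generated by the \<open>G w\<close> in \<open>poly_ring V\<close>; see \<open>genideal_poly_ring\<close>.
\<close>

definition gen_ideal :: "nat set \<Rightarrow> ('i \<Rightarrow> 'a::comm_ring_1 mpoly) \<Rightarrow> 'i set \<Rightarrow> 'a mpoly set" where
  "gen_ideal V G W = {f. \<exists>h. (\<forall>w\<in>W. vars (h w) \<subseteq> V) \<and> f = (\<Sum>w\<in>W. h w * G w)}"

definition ideal_plus :: "'a::comm_ring_1 mpoly set \<Rightarrow> 'a mpoly set \<Rightarrow> 'a mpoly set" where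
  "ideal_plus I J = {f + g | f g. f \<in> I \<and> g \<in> J}"

context
  fixes V :: "nat set" and I :: "'a::comm_ring_1 mpoly set"
  assumes I: "is_ideal V I"
begin

lemma ideal_0: "0 \<in> I"
  using I by (simp add: is_ideal_def)

lemma ideal_vars: "f \<in> I \<Longrightarrow> vars f \<subseteq> V"
  using I by (simp add: is_ideal_def)

lemma ideal_add: "f \<in> I \<Longrightarrow> g \<in> I \<Longrightarrow> f + g \<in> I"
  using I by (simp add: is_ideal_def)

lemma ideal_mult: "f \<in> I \<Longrightarrow> vars g \<subseteq> V \<Longrightarrow> g * f \<in> I"
  using I by (simp add: is_ideal_def)

lemma ideal_mult_right: "f \<in> I \<Longrightarrow> vars g \<subseteq> V \<Longrightarrow> f * g \<in> I"
  using ideal_mult[of f g] by (simp add: mult.commute)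

lemma ideal_uminus: "f \<in> I \<Longrightarrow> - f \<in> I"
  using ideal_mult[of f "- 1"] by simp

lemma ideal_diff: "f \<in> I \<Longrightarrow> g \<in> I \<Longrightarrow> f - g \<in> I"
  using ideal_add[of f "- g"] ideal_uminus[of g] by simp

lemma ideal_sum: "(\<And>i. i \<in> A \<Longrightarrow> f i \<in> I) \<Longrightarrow> sum f A \<in> I"
  by (induction A rule: infinite_finite_induct) (simp_all add: ideal_0 ideal_add)

lemma ideal_cong: "f - g \<in> I \<Longrightarrow> f \<in> I \<longleftrightarrow> g \<in> I"
  using ideal_add[of "f - g" g] ideal_diff[of f "f - g"] by auto

lemma ideal_cong_trans: "f - g \<in> I \<Longrightarrow> g - h \<in> I \<Longrightarrow> f - h \<in> I"
  using ideal_add[of "f - g" "g - h"] by simp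

lemma ideal_cong_sym: "f - g \<in> I \<Longrightarrow> g - f \<in> I"
  using ideal_uminus[of "f - g"] by simp

lemma ideal_cong_power:
  assumes "f - g \<in> I" "vars f \<subseteq> V" "vars g \<subseteq> V"
  shows "f ^ n - g ^ n \<in> I"
proof (induction n)
  case (Suc n)
  have "f ^ Suc n - g ^ Suc n = f * (f ^ n - g ^ n) + g ^ n * (f - g)"
    by (simp add: algebra_simps)
  also have "\<dots> \<in> I"
    using assms Suc by (intro ideal_add ideal_mult vars_subset_intros)
  finally show ?case .
qed (simp add: ideal_0)

lemma ideal_power_le:
  assumes "f ^ m \<in> I" "m \<le> n" "vars f \<subseteq> V"
  shows "f ^ n \<in> I"
proof -
  have "f ^ n = f ^ (n - m) * f ^ m"
    using assms(2) by (simp add: power_add[symmetric])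
  then show ?thesis
    using assms by (simp add: ideal_mult vars_power_subset)
qed

end

lemma gen_idealE:
  assumes "f \<in> gen_ideal V G W"
  obtains h where "\<forall>w\<in>W. vars (h w) \<subseteq> V" "f = (\<Sum>w\<in>W. h w * G w)"
  using assms unfolding gen_ideal_def by blast

lemma gen_idealI:
  assumes "\<And>w. w \<in> W \<Longrightarrow> vars (h w) \<subseteq> V" "f = (\<Sum>w\<in>W. h w * G w)"
  shows "f \<in> gen_ideal V G W"
  using assms unfolding gen_ideal_def by blast

lemma is_ideal_gen_ideal:
  fixes G :: "'i \<Rightarrow> 'a::comm_ring_1 mpoly"
  assumes "\<And>w. w \<in> W \<Longrightarrow> vars (G w) \<subseteq> V"
  shows "is_ideal V (gen_ideal V G W)"
  unfolding is_ideal_def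
proof (intro conjI ballI allI impI)
  show "0 \<in> gen_ideal V G W"
    by (rule gen_idealI[of _ "\<lambda>_. 0"]) simp_all
  show "vars f \<subseteq> V" if f: "f \<in> gen_ideal V G W" for f
    using f by (rule gen_idealE) (simp add: assms vars_sum_subset vars_mult_subset)
  show "f + g \<in> gen_ideal V G W" if f: "f \<in> gen_ideal V G W" and g: "g \<in> gen_ideal V G W" for f g
  proof -
    from f obtain h where h: "\<forall>w\<in>W. vars (h w) \<subseteq> V" "f = (\<Sum>w\<in>W. h w * G w)"
      by (rule gen_idealE)
    from g obtain k where k: "\<forall>w\<in>W. vars (k w) \<subseteq> V" "g = (\<Sum>w\<in>W. k w * G w)"
      by (rule gen_idealE)
    show ?thesis
      by (rule gen_idealI[of _ "\<lambda>w. h w + k w"])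
        (simp_all add: h k vars_add_subset distrib_right sum.distrib)
  qed
  show "g * f \<in> gen_ideal V G W" if f: "f \<in> gen_ideal V G W" and g: "vars g \<subseteq> V" for f g
  proof -
    from f obtain h where h: "\<forall>w\<in>W. vars (h w) \<subseteq> V" "f = (\<Sum>w\<in>W. h w * G w)"
      by (rule gen_idealE)
    show ?thesis
      by (rule gen_idealI[of _ "\<lambda>w. g * h w"])
        (simp_all add: h g vars_mult_subset sum_distrib_left mult.assoc)
  qed
qed

lemma gen_ideal_generator:
  assumes "finite W" "w \<in> W"
  shows "G w \<in> gen_ideal V G W"
  unfolding gen_ideal_def using assms
  by (intro CollectI exI[of _ "\<lambda>v. if v = w then 1 else 0"]) (auto simp: if_distrib[of "\<lambda>x. x * _"] cong: if_cong)

lemma gen_ideal_least: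
  assumes "is_ideal V I" "\<And>w. w \<in> W \<Longrightarrow> G w \<in> I"
  shows "gen_ideal V G W \<subseteq> I"
  unfolding gen_ideal_def using assms by (auto intro!: ideal_sum[OF assms(1)] ideal_mult[OF assms(1)])

lemma is_ideal_plus:
  assumes "is_ideal V I" "is_ideal V J"
  shows "is_ideal V (ideal_plus I J)"
  unfolding is_ideal_def
proof (intro conjI ballI allI impI)
  show "0 \<in> ideal_plus I J"
    unfolding ideal_plus_def using assms by (auto intro!: exI[of _ 0] ideal_0)
  show "vars f \<subseteq> V" if "f \<in> ideal_plus I J" for f
    using that ideal_vars[OF assms(1)] ideal_vars[OF assms(2)] vars_add_subset
    unfolding ideal_plus_def by blast
  show "f + g \<in> ideal_plus I J" if fg: "f \<in> ideal_plus I J" "g \<in> ideal_plus I J" for f g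
  proof -
    obtain a b a' b' where "f = a + b" "g = a' + b'" "a \<in> I" "b \<in> J" "a' \<in> I" "b' \<in> J"
      using fg by (auto simp: ideal_plus_def)
    then show ?thesis
      unfolding ideal_plus_def using ideal_add[OF assms(1)] ideal_add[OF assms(2)]
      by (intro CollectI exI[of _ "a + a'"] exI[of _ "b + b'"]) simp
  qed
  show "g * f \<in> ideal_plus I J" if f: "f \<in> ideal_plus I J" and g: "vars g \<subseteq> V" for f g
  proof -
    obtain a b where "f = a + b" "a \<in> I" "b \<in> J"
      using f by (auto simp: ideal_plus_def)
    then show ?thesis
      unfolding ideal_plus_def using ideal_mult[OF assms(1)] ideal_mult[OF assms(2)] g
      by (intro CollectI exI[of _ "g * a"] exI[of _ "g * b"]) (simp add: distrib_left)
  qed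
qed

lemma ideal_plus_left: "is_ideal V J \<Longrightarrow> f \<in> I \<Longrightarrow> f \<in> ideal_plus I J"
  unfolding ideal_plus_def using ideal_0[of V J] by force

lemma ideal_plus_right: "is_ideal V I \<Longrightarrow> f \<in> J \<Longrightarrow> f \<in> ideal_plus I J"
  unfolding ideal_plus_def using ideal_0[of V I] by force

section \<open>Regularity and reduction to the zero-dimensional quotient\<close>

context poly_system
begin

abbreviation ideal_of :: "nat set \<Rightarrow> 'a mpoly set" where
  "ideal_of W \<equiv> gen_ideal V G W"

lemma G_vars: "v \<in> V \<Longrightarrow> vars (G v) \<subseteq> V"
  using G_polys polys_vars by blast

lemma ideal_of_is_ideal: "W \<subseteq> V \<Longrightarrow> is_ideal V (ideal_of W)"
  by (rule is_ideal_gen_ideal) (use G_vars in blast)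

lemma finite_sub: "W \<subseteq> V \<Longrightarrow> finite W"
  using finite_V by (rule finite_subset[rotated])

lemma ideal_of_insert_subset:
  assumes "insert w W \<subseteq> V"
  shows "ideal_of W \<subseteq> ideal_of (insert w W)"
  using assms by (intro gen_ideal_least ideal_of_is_ideal gen_ideal_generator finite_sub) auto

lemma ideal_of_insertE:
  assumes "insert w W \<subseteq> V" "w \<notin> W" "f \<in> ideal_of (insert w W)"
  obtains g where "vars g \<subseteq> V" "f - G w * g \<in> ideal_of W"
proof -
  obtain h where h: "\<forall>u\<in>insert w W. vars (h u) \<subseteq> V" "f = (\<Sum>u\<in>insert w W. h u * G u)"
    using assms(3) by (rule gen_idealE)
  have "f - G w * h w = (\<Sum>u\<in>W. h u * G u)"
    using h(2) assms finite_sub[of W] by (simp add: mult.commute)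
  with h have "f - G w * h w \<in> ideal_of W"
    by (intro gen_idealI) auto
  with h that show ?thesis
    by blast
qed

text \<open>
  The exponent \<open>n = 0\<close> is harmless: an ideal that contains \<open>f\<^sup>0 = 1\<close> contains every \<open>f\<close>.
\<close>

definition radical_closed :: "nat set \<Rightarrow> bool" where
  "radical_closed W \<longleftrightarrow> (\<forall>f n. vars f \<subseteq> V \<longrightarrow> f ^ n \<in> ideal_of W \<longrightarrow> f \<in> ideal_of W)"

end

context rewriting_system
begin

lemma adic_inj:
  assumes "vars f \<subseteq> V" "vars g \<subseteq> V" "adic f = adic g"
  shows "f = g"
  using adic_eq_0[of "f - g"] assms by (simp add: lin_diff vars_diff_subset)

text \<open>
  The ideal generated by the \<open>G\<^sub>w\<close>, \<open>w \<in> W\<close>, is the image under \<open>adic\<close> of the ideal generated by the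
  powers \<open>X\<^sub>w\<^sup>d\<close>, and membership in a monomial ideal is tested on each monomial separately.
\<close>

lemma adic_in_ideal_of_iff:
  assumes W: "W \<subseteq> V" and f: "vars f \<subseteq> V"
  shows "adic f \<in> ideal_of W \<longleftrightarrow> (\<forall>m\<in>keys f. \<exists>w\<in>W. d \<le> lookup m w)"
proof
  assume "adic f \<in> ideal_of W"
  then obtain h where h: "\<forall>w\<in>W. vars (h w) \<subseteq> V" "adic f = (\<Sum>w\<in>W. h w * G w)"
    by (rule gen_idealE)
  have "\<forall>w\<in>W. \<exists>k. vars k \<subseteq> V \<and> adic k = h w"
    using adic_onto h(1) by metis
  then obtain k where k: "\<And>w. w \<in> W \<Longrightarrow> vars (k w) \<subseteq> V" "\<And>w. w \<in> W \<Longrightarrow> adic (k w) = h w"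
    by metis
  have "adic f = (\<Sum>w\<in>W. G w * adic (k w))"
    unfolding h(2) by (intro sum.cong refl) (simp add: k(2) mult.commute)
  also have "\<dots> = adic (\<Sum>w\<in>W. mon (vpow w d) * k w)"
    using W by (auto simp: lin_sum adic_shift intro!: sum.cong)
  finally have Ef: "adic f = adic (\<Sum>w\<in>W. mon (vpow w d) * k w)" .
  have "f = (\<Sum>w\<in>W. mon (vpow w d) * k w)"
  proof (rule adic_inj[OF f _ Ef], intro vars_sum_subset vars_mult_subset)
    fix w assume "w \<in> W"
    with W k(1) show "vars (mon (vpow w d) :: 'a mpoly) \<subseteq> V" "vars (k w) \<subseteq> V"
      by (auto simp: vars_mon)
  qed
  then have "keys f \<subseteq> (\<Union>w\<in>W. keys (mon (vpow w d) * k w))"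
    by (metis Poly_Mapping.keys_sum)
  also have "\<dots> \<subseteq> (\<Union>w\<in>W. (\<lambda>m. vpow w d + m) ` keys (k w))"
    using keys_mon_mult by fast
  finally have sub: "keys f \<subseteq> (\<Union>w\<in>W. (\<lambda>m. vpow w d + m) ` keys (k w))" .
  show "\<forall>m\<in>keys f. \<exists>w\<in>W. d \<le> lookup m w"
  proof
    fix m assume "m \<in> keys f"
    then obtain w n where "w \<in> W" "m = vpow w d + n"
      using sub by blast
    then show "\<exists>w\<in>W. d \<le> lookup m w"
      by (intro bexI[of _ w]) (simp_all add: lookup_add)
  qed
next
  assume *: "\<forall>m\<in>keys f. \<exists>w\<in>W. d \<le> lookup m w"
  have "adic_mono V d G m \<in> ideal_of W" if m: "m \<in> keys f" for m
  proof -
    obtain w where w: "w \<in> W" "d \<le> lookup m w"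
      using * m by blast
    obtain n where n: "m = n + vpow w d"
      using w(2) by (rule single_le_split)
    have n_V: "keys n \<subseteq> V"
    proof -
      have "keys n \<subseteq> keys m"
        by (simp add: n keys_plus_nat)
      also have "keys m \<subseteq> V"
        using f m unfolding vars_def by blast
      finally show ?thesis .
    qed
    have "vars (adic_mono V d G n) \<subseteq> V"
      using adic_vars[of "mon n"] n_V by (simp add: vars_mon)
    moreover have "adic_mono V d G m = adic_mono V d G n * G w"
      unfolding n using w W by (subst adic_mono_shift) (auto simp: d_pos)
    ultimately show ?thesis
      using w W by (simp add: ideal_mult[OF ideal_of_is_ideal] gen_ideal_generator finite_sub)
  qed
  then show "adic f \<in> ideal_of W"
    unfolding lin_def using W by (intro ideal_sum[OF ideal_of_is_ideal] ideal_mult[OF ideal_of_is_ideal]) auto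
qed

text \<open>
  Under \<open>adic\<close> this becomes the same statement about the monomial ideal generated by \<open>X\<^sub>u\<^sup>d\<close>, \<open>u \<in> W\<close>,
  where multiplication by \<open>X\<^sub>w\<^sup>d\<close> does not change the exponents of the variables in \<open>W\<close>.
\<close>

lemma nonzerodivisor:
  assumes "insert w W \<subseteq> V" "w \<notin> W" "vars f \<subseteq> V" "G w * f \<in> ideal_of W"
  shows "f \<in> ideal_of W"
proof -
  obtain g where g: "vars g \<subseteq> V" "adic g = f"
    using adic_onto[OF assms(3)] .
  have "vars (mon (vpow w d) * g) \<subseteq> V"
    using assms(1) g(1) by (intro vars_mult_subset) (auto simp: vars_mon)
  moreover have "adic (mon (vpow w d) * g) \<in> ideal_of W"
    using assms g by (simp add: adic_shift)
  ultimately have *: "\<forall>m\<in>keys (mon (vpow w d) * g). \<exists>u\<in>W. d \<le> lookup m u"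
    using assms(1) adic_in_ideal_of_iff[of W] by auto
  have "\<exists>u\<in>W. d \<le> lookup m u" if m: "m \<in> keys g" for m
  proof -
    have "vpow w d + m \<in> keys (mon (vpow w d) * g)"
      using m by (simp add: in_keys_iff)
    then obtain u where "u \<in> W" "d \<le> lookup (vpow w d + m) u"
      using * by blast
    then show ?thesis
      using assms(2) by (auto simp: lookup_add lookup_single when_def split: if_splits)
  qed
  then show ?thesis
    using adic_in_ideal_of_iff[of W g] assms(1) g by auto
qed

lemma nonzerodivisor_power:
  assumes "insert w W \<subseteq> V" "w \<notin> W" "vars f \<subseteq> V" "G w ^ n * f \<in> ideal_of W"
  shows "f \<in> ideal_of W"
  using assms(4)
proof (induction n)
  case (Suc n)
  have "vars (G w ^ n * f) \<subseteq> V"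
    using assms G_vars by (intro vars_subset_intros) auto
  then have "G w ^ n * f \<in> ideal_of W"
    using Suc.prems unfolding power_Suc mult.assoc by (rule nonzerodivisor[OF assms(1,2)])
  then show ?case
    by (rule Suc.IH)
qed simp

lemma one_notin_ideal_of: "W \<subseteq> V \<Longrightarrow> 1 \<notin> ideal_of W"
  using adic_in_ideal_of_iff[of W 1] d_pos by simp

lemma generator_notin_ideal_of:
  assumes "insert w W \<subseteq> V" "w \<notin> W"
  shows "G w \<notin> ideal_of W"
  using nonzerodivisor[of w W 1] one_notin_ideal_of[of W] assms by auto

lemma adic_shift_power:
  assumes "w \<in> V"
  shows "adic (mon (vpow w (d * n)) * f) = G w ^ n * adic f"
proof (induction n)
  case (Suc n)
  have "(mon (vpow w (d * Suc n)) :: 'a mpoly) = mon (vpow w d) * mon (vpow w (d * n))"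
    by (simp add: mult_single single_add[symmetric])
  then show ?case
    by (simp only: mult.assoc adic_shift[OF assms] Suc power_Suc)
qed simp

text \<open>
  Krull's intersection theorem in the present situation: under \<open>adic\<close> the power \<open>G\<^sub>w\<^sup>n\<close> becomes
  \<open>X\<^bsub>w\<^esub>\<^bsup>d n\<^esup>\<close>, which divides no monomial of a given polynomial once \<open>n\<close> is large.
\<close>

lemma ideal_of_separated:
  assumes w: "insert w W \<subseteq> V" "w \<notin> W" and f: "vars f \<subseteq> V"
    and *: "\<And>n. \<exists>g. vars g \<subseteq> V \<and> f - G w ^ n * g \<in> ideal_of W"
  shows "f \<in> ideal_of W"
proof -
  obtain k where k: "vars k \<subseteq> V" "adic k = f"
    using adic_onto[OF f] .
  define n where "n = Suc (\<Sum>m\<in>keys k. mono_degree m)"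
  obtain g where g: "vars g \<subseteq> V" "f - G w ^ n * g \<in> ideal_of W"
    using * by blast
  obtain g' where g': "vars g' \<subseteq> V" "adic g' = g"
    using adic_onto[OF g(1)] .
  let ?h = "mon (vpow w (d * n)) * g'"
  have "adic (k - ?h) = f - G w ^ n * g"
    using w k g' by (simp add: lin_diff adic_shift_power)
  moreover have "vars (k - ?h) \<subseteq> V"
    using w k g' by (intro vars_diff_subset vars_mult_subset) (auto simp: vars_mon)
  ultimately have kh: "\<forall>m\<in>keys (k - ?h). \<exists>u\<in>W. d \<le> lookup m u"
    using adic_in_ideal_of_iff[of W "k - ?h"] w g(2) by auto
  have "\<exists>u\<in>W. d \<le> lookup m u" if m: "m \<in> keys k" for m
  proof -
    have "lookup m w \<le> mono_degree m"
      by (rule lookup_le_mono_degree)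
    also have "\<dots> < n"
      using m member_le_sum[of m "keys k" mono_degree] by (simp add: n_def)
    also have "n \<le> d * n"
      using d_pos by simp
    finally have "m \<notin> keys ?h"
      using keys_mon_mult[of "vpow w (d * n)" g'] by (auto simp: lookup_add)
    then have "m \<in> keys (k - ?h)"
      using m by (simp add: in_keys_iff lookup_minus)
    then show ?thesis
      using kh by blast
  qed
  then show ?thesis
    using adic_in_ideal_of_iff[of W k] w k by auto
qed

text \<open>
  Let \<open>f\<^sup>n\<close> lie in the smaller ideal.  As the larger ideal is radical, \<open>f\<close> is a multiple of \<open>G\<^sub>w\<close> modulo
  the smaller one, say \<open>f = G\<^sub>w h\<close>; and as \<open>G\<^sub>w\<close> is not a zero divisor, \<open>h\<^sup>n\<close> lies in the smaller ideal
  again.  Thus \<open>f\<close> is divisible by all powers of \<open>G\<^sub>w\<close>.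
\<close>

lemma radical_closed_step:
  assumes w: "insert w W \<subseteq> V" "w \<notin> W" and rad: "radical_closed (insert w W)"
  shows "radical_closed W"
  unfolding radical_closed_def
proof (intro allI impI)
  fix f n assume f: "vars f \<subseteq> V" "f ^ n \<in> ideal_of W"
  have W: "W \<subseteq> V" and wV: "w \<in> V"
    using w by auto
  note ideal_of = ideal_of_is_ideal[OF W]
  have "\<exists>g. vars g \<subseteq> V \<and> f - G w ^ k * g \<in> ideal_of W \<and> g ^ n \<in> ideal_of W" for k
  proof (induction k)
    case 0
    show ?case
      using f by (intro exI[of _ f]) (simp add: ideal_0[OF ideal_of])
  next
    case (Suc k)
    then obtain g where g: "vars g \<subseteq> V" "f - G w ^ k * g \<in> ideal_of W" "g ^ n \<in> ideal_of W"
      by blast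
    have "g \<in> ideal_of (insert w W)"
      using rad g ideal_of_insert_subset[OF w(1)] unfolding radical_closed_def by blast
    then obtain h where h: "vars h \<subseteq> V" "g - G w * h \<in> ideal_of W"
      using ideal_of_insertE[OF w] by blast
    have Gh: "vars (G w * h) \<subseteq> V"
      using h G_vars[OF wV] by (simp add: vars_mult_subset)
    have "f - G w ^ Suc k * h = (f - G w ^ k * g) + G w ^ k * (g - G w * h)"
      by (simp add: algebra_simps)
    also have "\<dots> \<in> ideal_of W"
      using g h G_vars[OF wV] by (intro ideal_add[OF ideal_of] ideal_mult[OF ideal_of] vars_power_subset)
    finally have 1: "f - G w ^ Suc k * h \<in> ideal_of W" .
    have "g ^ n - (G w * h) ^ n \<in> ideal_of W"
      using g h Gh by (intro ideal_cong_power[OF ideal_of])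
    then have "(G w * h) ^ n \<in> ideal_of W"
      using g(3) ideal_cong[OF ideal_of] by blast
    then have "G w ^ n * h ^ n \<in> ideal_of W"
      by (simp add: power_mult_distrib)
    then have "h ^ n \<in> ideal_of W"
      using h(1) by (intro nonzerodivisor_power[OF w vars_power_subset])
    with 1 h show ?case
      by blast
  qed
  then show "f \<in> ideal_of W"
    using ideal_of_separated[OF w f(1)] by blast
qed

lemma radical_closed_subset:
  assumes "radical_closed V" "W \<subseteq> V"
  shows "radical_closed W"
proof -
  have "radical_closed (V - U)" if "finite U" "U \<subseteq> V" for U
    using that
  proof (induction U rule: finite_induct)
    case (insert u U)
    show ?case
    proof (rule radical_closed_step)
      show "insert u (V - insert u U) \<subseteq> V" "u \<notin> V - insert u U"
        using insert.prems by auto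
      have "insert u (V - insert u U) = V - U"
        using insert.prems insert.hyps by auto
      then show "radical_closed (insert u (V - insert u U))"
        using insert by simp
    qed
  qed (use assms in simp)
  from this[of "V - W"] show ?thesis
    using assms(2) by (simp add: double_diff)
qed

text \<open>
  Together with the finiteness of the field this makes the quotient by \<open>G\<close> a finite ring.
\<close>

lemma reduced_representative:
  assumes "vars f \<subseteq> V"
  obtains b where "b \<in> polys V (card V * (d - 1))" "f - b \<in> ideal_of V"
proof -
  obtain k where k: "vars k \<subseteq> V" "adic k = f"
    using adic_onto[OF assms] .
  define b where "b = (\<Sum>m\<in>{m \<in> keys k. reduced V d m}. Const (lookup k m) * mon m)"
  have lb: "lookup b m = (if m \<in> keys k \<and> reduced V d m then lookup k m else 0)" for m
    unfolding b_def lookup_sum by (simp add: lookup_single when_def if_distrib[of "\<lambda>x. _ * x"] cong: if_cong)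
  have kb: "keys b = {m \<in> keys k. reduced V d m}"
    by (auto simp: in_keys_iff lb split: if_splits)
  have kV: "keys m \<subseteq> V" if "m \<in> keys k" for m
    using k(1) that by (auto simp: vars_def)
  have "b \<in> polys V (card V * (d - 1))"
    using kb kV reduced_degree_le[OF finite_V] by (auto simp: polys_def monoms_def)
  moreover have "f - b \<in> ideal_of V"
  proof -
    have "adic b = b"
      using kb kV by (intro adic_reduced) auto
    then have "f - b = adic (k - b)"
      by (simp add: lin_diff k)
    moreover have "vars b \<subseteq> V"
      using calculation polys_vars \<open>b \<in> polys V (card V * (d - 1))\<close> by blast
    moreover have "\<exists>w\<in>V. d \<le> lookup m w" if "m \<in> keys (k - b)" for m
    proof -
      have "lookup k m \<noteq> lookup b m"
        using that by (simp add: in_keys_iff lookup_minus)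
      then have "\<not> reduced V d m"
        by (auto simp: lb in_keys_iff split: if_splits)
      then show ?thesis
        by (auto simp: reduced_def not_less)
    qed
    ultimately show ?thesis
      using k by (simp add: adic_in_ideal_of_iff vars_diff_subset)
  qed
  ultimately show ?thesis
    by (rule that)
qed

lemma reduced_in_ideal_of_eq_0:
  assumes "b \<in> ideal_of V" "\<And>m. m \<in> keys b \<Longrightarrow> reduced V d m \<and> keys m \<subseteq> V"
  shows "b = 0"
proof -
  have "vars b \<subseteq> V"
    using assms(2) by (auto simp: vars_def)
  then have "\<forall>m\<in>keys b. \<exists>w\<in>V. d \<le> lookup m w"
    using adic_in_ideal_of_iff[of V b] adic_reduced[of b] assms by auto
  then have "keys b = {}"
    using assms(2) unfolding reduced_def by (meson equals0I leD)
  then show ?thesis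
    by simp
qed

end

section \<open>Partial derivatives\<close>

definition pd :: "nat \<Rightarrow> 'a::comm_ring_1 mpoly \<Rightarrow> 'a mpoly" where
  "pd l f = lin (\<lambda>m. Const (of_nat (lookup m l)) * mon (m - vpow l 1)) f"

lemma pd_add: "pd l (f + g) = pd l f + pd l g"
  by (simp add: pd_def lin_add)

lemma pd_Const_mult: "pd l (Const c * f) = Const c * pd l f"
  by (simp add: pd_def lin_Const_mult)

lemma pd_Const [simp]: "pd l (Const c) = 0"
  by (simp add: pd_def lin_Const)

text \<open>
  Polynomials are built up from constants by addition and multiplication with variables
  (\<open>mpoly_induct\<close>), so this case of the product rule determines the derivative.
\<close>

lemma pd_Var_mult: "pd l (Var u * f) = (if u = l then f else 0) + Var u * pd l f"
proof -
  have eq: "Const (of_nat (lookup (vpow u 1 + m) l)) * mon (vpow u 1 + m - vpow l 1)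
      = (if u = l then mon m else 0) + mon (vpow u 1) * (Const (of_nat (lookup m l)) * mon (m - vpow l 1) :: 'a mpoly)" for m
  proof (cases "u = l")
    case True
    have "vpow l 1 + m - vpow l 1 = m"
      by simp
    moreover have "Const (of_nat (lookup m l)) * mon m
        = mon (vpow l 1) * (Const (of_nat (lookup m l)) * mon (m - vpow l 1) :: 'a mpoly)"
    proof (cases "lookup m l = 0")
      case False
      then obtain n where "m = n + vpow l 1"
        using single_le_split[of 1 m l] by auto
      then show ?thesis
        by (simp add: mon_mult mult_ac del: One_nat_def)
    qed simp
    ultimately show ?thesis
      using True by (simp add: lookup_add Const_add distrib_right)
  next
    case False
    then have "lookup (vpow u 1 + m) l = lookup m l"
      by (simp add: lookup_add lookup_single)
    moreover have "mon (vpow u 1 + m - vpow l 1) = mon (vpow u 1) * (mon (m - vpow l 1) :: 'a mpoly)"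
      if "lookup m l \<noteq> 0"
    proof -
      have "1 \<le> lookup m l"
        using that by simp
      then obtain n where m: "m = n + vpow l 1"
        by (rule single_le_split)
      have "vpow u 1 + m - vpow l 1 = vpow u 1 + n"
        unfolding m add.assoc[symmetric] by (rule add_diff_cancel_right')
      then show ?thesis
        unfolding m by (simp only: add_diff_cancel_right' mon_mult)
    qed
    ultimately show ?thesis
      using False by (cases "lookup m l = 0") (simp_all add: mult_ac)
  qed
  have "pd l (Var u * f) = lin (\<lambda>m. (if u = l then mon m else 0)
      + mon (vpow u 1) * (Const (of_nat (lookup m l)) * mon (m - vpow l 1))) f"
    unfolding pd_def Var_def[of u] lin_mult_mon eq ..
  also have "\<dots> = lin (\<lambda>m. if u = l then mon m else 0) f + mon (vpow u 1) * pd l f"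
    unfolding pd_def lin_mult[symmetric] by (simp add: lin_def distrib_left sum.distrib)
  also have "lin (\<lambda>m. if u = l then mon m else 0) f = (if u = l then f else 0)"
    by (simp add: lin_def[of "\<lambda>m. 0"])
  finally show ?thesis
    by (simp add: Var_def)
qed

lemma pd_Var_power: "pd l (Var v ^ k) = (if v = l then Const (of_nat k) * Var v ^ (k - 1) else 0)"
proof (induction k)
  case 0
  show ?case
    using pd_Const[of l 1] by simp
next
  case (Suc k)
  have "Var v * (Const (of_nat k) * Var v ^ (k - 1)) = (Const (of_nat k) * Var v ^ k :: 'a mpoly)"
    by (cases k) (simp_all add: mult_ac)
  then show ?case
    unfolding power_Suc pd_Var_mult Suc.IH
    by (cases "v = l") (simp_all add: Const_add distrib_right)
qed

lemma pd_1 [simp]: "pd l 1 = 0"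
  using pd_Const[of l 1] by simp

lemma pd_minus_1 [simp]: "pd l (- 1) = 0"
  using pd_Const[of l "- 1"] by (simp add: Const_def single_uminus)

lemma pd_Var: "pd l (Var v) = (if v = l then 1 else 0)"
  using pd_Var_mult[of l v 1] by simp

lemma pd_mon_polys:
  assumes "m \<in> monoms V e"
  shows "Const (of_nat (lookup m l)) * mon (m - vpow l 1) \<in> (polys V (e - 1) :: 'a::comm_ring_1 mpoly set)"
proof (cases "lookup m l = 0")
  case False
  then have "1 \<le> lookup m l"
    by simp
  then obtain n where m: "m = n + vpow l 1"
    by (rule single_le_split)
  have "n \<in> monoms V (e - 1)"
    using assms by (auto simp: m monoms_def keys_plus_nat)
  then have "mon (m - vpow l 1) \<in> (polys V (e - 1) :: 'a mpoly set)"
    by (simp add: m del: One_nat_def)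
  then show ?thesis
    by (rule polys_Const_mult)
qed simp

lemma pd_polys: "f \<in> polys V e \<Longrightarrow> pd l f \<in> polys V (e - 1)"
  unfolding pd_def by (intro lin_in_polys pd_mon_polys) (auto simp: polys_def)

lemma pd_vars: "vars f \<subseteq> V \<Longrightarrow> vars (pd l f) \<subseteq> V"
  unfolding vars_subset_iff using pd_polys by blast

lemma mpoly_induct [consumes 1, case_names Const Var add]:
  fixes f :: "'a::comm_ring_1 mpoly"
  assumes "vars f \<subseteq> V"
    and Const: "\<And>c. P (Const c)"
    and Var: "\<And>v g. v \<in> V \<Longrightarrow> vars g \<subseteq> V \<Longrightarrow> P g \<Longrightarrow> P (Var v * g)"
    and add: "\<And>g h. vars g \<subseteq> V \<Longrightarrow> vars h \<subseteq> V \<Longrightarrow> P g \<Longrightarrow> P h \<Longrightarrow> P (g + h)"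
  shows "P f"
proof -
  have mono: "P (Const c * mon m) \<and> vars (Const c * mon m) \<subseteq> V" if "keys m \<subseteq> V" for c m
    using that
  proof (induction "mono_degree m" arbitrary: m)
    case 0
    then have "m = 0"
      by (auto simp: mono_degree_def in_keys_iff intro!: poly_mapping_eqI)
    then show ?case
      using Const[of c] by simp
  next
    case (Suc k)
    then have "keys m \<noteq> {}"
      by (auto simp: mono_degree_def)
    then obtain u where "u \<in> keys m"
      by blast
    then have "1 \<le> lookup m u"
      by (simp add: in_keys_iff Suc_le_eq)
    then obtain n where m: "m = n + vpow u 1"
      by (rule single_le_split)
    have n: "keys n \<subseteq> V" "u \<in> V" "k = mono_degree n"
      using Suc.prems Suc.hyps(2) by (auto simp: m keys_plus_nat)
    have eq: "Const c * mon m = Var u * (Const c * mon n)"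
      unfolding m mon_mult Var_def by (simp add: mult_ac)
    show ?case
      unfolding eq using Suc.hyps(1)[OF n(3,1)] n(2) Var by (simp add: vars_mult_subset)
  qed
  have "P (\<Sum>m\<in>M. Const (lookup f m) * mon m) \<and> vars (\<Sum>m\<in>M. Const (lookup f m) * mon m) \<subseteq> V"
    if "finite M" "M \<subseteq> keys f" for M
    using that
  proof (induction M rule: finite_induct)
    case empty
    then show ?case
      using Const[of 0] by simp
  next
    case (insert m M)
    have "keys m \<subseteq> V"
      using insert.prems assms(1) by (auto simp: vars_def)
    then show ?case
      using insert mono[of m] add by (simp add: vars_add_subset)
  qed
  from this[of "keys f"] show ?thesis
    using poly_expand[of "keys f" f] by simp
qed

section \<open>Frobenius and the Jacobian criterion\<close>

lemma prime_CHAR_field: "prime (CHAR('a::{field,finite}))"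
  by (rule prime_CHAR_semidom) (rule finite_imp_CHAR_pos, simp)

lemma CHAR_mpoly: "CHAR('a::comm_ring_1 mpoly) = CHAR('a)"
proof (rule CHAR_eqI)
  have of_nat: "(of_nat n :: 'a mpoly) = Const (of_nat n)" for n
    by (simp add: Const_def)
  show "of_nat CHAR('a) = (0 :: 'a mpoly)"
    by (simp add: of_nat del: single_of_nat)
  show "CHAR('a) dvd n" if "of_nat n = (0 :: 'a mpoly)" for n
  proof -
    have "lookup (Const (of_nat n :: 'a)) 0 = 0"
      using that by (simp add: of_nat del: single_of_nat)
    then show ?thesis
      by (simp add: Const_def of_nat_eq_0_iff_char_dvd del: single_of_nat)
  qed
qed

lemma frobenius_add:
  fixes f g :: "'a::{field,finite} mpoly"
  assumes "Q = CHAR('a) ^ N"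
  shows "(f + g) ^ Q = f ^ Q + g ^ Q"
  using freshmans_dream'[of Q N f g] assms by (simp add: CHAR_mpoly prime_CHAR_field)

definition frob_diff :: "nat \<Rightarrow> 'a::comm_ring_1 mpoly \<Rightarrow> 'a mpoly" where
  "frob_diff Q f = f - f ^ Q"

lemma frob_diff_vars: "vars f \<subseteq> V \<Longrightarrow> vars (frob_diff Q f) \<subseteq> V"
  unfolding frob_diff_def by (intro vars_subset_intros)

text \<open>
  The square of the ideal generated by the elements \<open>X\<^sub>v - X\<^sub>v\<^sup>Q\<close>.
\<close>

definition frob_diff_square :: "nat set \<Rightarrow> nat \<Rightarrow> 'a::comm_ring_1 mpoly set" where
  "frob_diff_square V Q = gen_ideal V (\<lambda>(u, v). frob_diff Q (Var u) * frob_diff Q (Var v)) (V \<times> V)"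

lemma is_ideal_frob_diff_square: "is_ideal V (frob_diff_square V Q)"
  unfolding frob_diff_square_def
proof (rule is_ideal_gen_ideal)
  fix p assume "p \<in> V \<times> V"
  then obtain u v where "p = (u, v)" "u \<in> V" "v \<in> V"
    by blast
  then show "vars (case p of (u, v) \<Rightarrow> frob_diff Q (Var u :: 'a mpoly) * frob_diff Q (Var v)) \<subseteq> V"
    by (simp add: vars_mult_subset frob_diff_vars)
qed

text \<open>
  The coefficients are fixed by the \<open>Q\<close>-th power, so \<open>f\<^sup>Q = f(X\<^sup>Q)\<close>, and this is the Taylor formula of
  first order between the points \<open>X\<close> and \<open>X\<^sup>Q\<close>.  In other words, \<open>f \<mapsto> f - f\<^sup>Q\<close> is a derivation up to
  terms of second order.
\<close>

lemma frobenius_taylor: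
  fixes f :: "'a::{field,finite} mpoly"
  assumes V: "finite V" and Q: "Q = CHAR('a) ^ N" "\<And>c::'a. c ^ Q = c" and f: "vars f \<subseteq> V"
  shows "frob_diff Q f - (\<Sum>l\<in>V. pd l f * frob_diff Q (Var l)) \<in> frob_diff_square V Q"
  using f
proof (induction rule: mpoly_induct)
  case (Const c)
  have "Const c ^ Q = Const c"
    by (simp only: Const_power[symmetric] Q(2))
  then show ?case
    by (simp add: frob_diff_def ideal_0[OF is_ideal_frob_diff_square])
next
  case (Var v g)
  let ?D = "\<lambda>f. frob_diff Q f - (\<Sum>l\<in>V. pd l f * frob_diff Q (Var l))"
  let ?\<delta> = "frob_diff Q (Var v :: 'a mpoly)"
  have "(\<Sum>l\<in>V. pd l (Var v * g) * frob_diff Q (Var l))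
      = (\<Sum>l\<in>V. (if v = l then g * ?\<delta> else 0)) + (\<Sum>l\<in>V. Var v * (pd l g * frob_diff Q (Var l)))"
    unfolding sum.distrib[symmetric] by (intro sum.cong) (auto simp: pd_Var_mult distrib_right mult.assoc)
  also have "\<dots> = g * ?\<delta> + Var v * (\<Sum>l\<in>V. pd l g * frob_diff Q (Var l))"
    using V Var by (simp add: sum_distrib_left)
  finally have sum: "(\<Sum>l\<in>V. pd l (Var v * g) * frob_diff Q (Var l)) = \<dots>" .
  have D: "?D (Var v * g) = (Var v - ?\<delta>) * ?D g - (\<Sum>l\<in>V. pd l g * (?\<delta> * frob_diff Q (Var l)))"
  proof -
    have "frob_diff Q (Var v * g) = Var v * frob_diff Q g + g * ?\<delta> - ?\<delta> * frob_diff Q g"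
      by (simp add: frob_diff_def power_mult_distrib algebra_simps)
    moreover have "(\<Sum>l\<in>V. pd l g * (?\<delta> * frob_diff Q (Var l))) = ?\<delta> * (\<Sum>l\<in>V. pd l g * frob_diff Q (Var l))"
      by (simp add: sum_distrib_left mult_ac)
    ultimately show ?thesis
      unfolding sum by (simp add: algebra_simps)
  qed
  have "?\<delta> * frob_diff Q (Var l) \<in> frob_diff_square V Q" if "l \<in> V" for l
    using gen_ideal_generator[of "V \<times> V" "(v, l)"
        "\<lambda>(u, v). frob_diff Q (Var u :: 'a mpoly) * frob_diff Q (Var v)" V] V Var that
    by (simp add: frob_diff_square_def)
  then have "(\<Sum>l\<in>V. pd l g * (?\<delta> * frob_diff Q (Var l))) \<in> frob_diff_square V Q"
    using Var(2) by (intro ideal_sum[OF is_ideal_frob_diff_square] ideal_mult[OF is_ideal_frob_diff_square _ pd_vars])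
  moreover have "(Var v - ?\<delta>) * ?D g \<in> frob_diff_square V Q"
    using Var by (intro ideal_mult[OF is_ideal_frob_diff_square] vars_diff_subset frob_diff_vars) simp_all
  ultimately show ?case
    by (simp only: D ideal_diff[OF is_ideal_frob_diff_square])
next
  case (add g h)
  let ?D = "\<lambda>f. frob_diff Q f - (\<Sum>l\<in>V. pd l f * frob_diff Q (Var l))"
  have "(\<Sum>l\<in>V. pd l (g + h) * frob_diff Q (Var l))
      = (\<Sum>l\<in>V. pd l g * frob_diff Q (Var l)) + (\<Sum>l\<in>V. pd l h * frob_diff Q (Var l))"
    by (simp add: pd_add distrib_right sum.distrib)
  moreover have "frob_diff Q (g + h) = frob_diff Q g + frob_diff Q h"
    by (simp add: frob_diff_def frobenius_add[OF Q(1)])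
  ultimately have "?D (g + h) = ?D g + ?D h"
    by simp
  then show ?case
    using add by (simp only: ideal_add[OF is_ideal_frob_diff_square])
qed

text \<open>
  Nakayama's lemma for nilpotent generators.  A product of more than \<open>card V * Q\<close> of the \<open>\<delta>\<^sub>v\<close> contains
  the \<open>Q\<close>-th power of one of them and lies in \<open>I\<close>.  If all products of \<open>k + 1\<close> factors lie in \<open>I\<close>, then
  so do those of \<open>k \<ge> 1\<close> factors, because one factor can be replaced by a combination of products of two.
\<close>

lemma nilpotent_absorb:
  fixes \<delta> :: "nat \<Rightarrow> 'a::comm_ring_1 mpoly"
  assumes I: "is_ideal V I" and V: "finite V" and \<delta>: "\<And>v. v \<in> V \<Longrightarrow> vars (\<delta> v) \<subseteq> V"
    and nil: "\<And>v. v \<in> V \<Longrightarrow> \<delta> v ^ Q \<in> I"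
    and sq: "\<And>v. v \<in> V \<Longrightarrow> \<delta> v \<in> ideal_plus I (gen_ideal V (\<lambda>(u, w). \<delta> u * \<delta> w) (V \<times> V))"
    and v: "v \<in> V"
  shows "\<delta> v \<in> I"
proof -
  define D where "D \<alpha> = (\<Prod>u\<in>V. \<delta> u ^ \<alpha> u)" for \<alpha> :: "nat \<Rightarrow> nat"
  have D_vars: "vars (D \<alpha>) \<subseteq> V" for \<alpha>
  proof -
    have "vars (\<Prod>u\<in>U. \<delta> u ^ \<alpha> u) \<subseteq> V" if "finite U" "U \<subseteq> V" for U
      using that by (induction U rule: finite_induct)
        (simp_all add: vars_mult_subset vars_power_subset \<delta>)
    then show ?thesis
      unfolding D_def using V by blast
  qed
  have D_split: "D \<alpha> = \<delta> u ^ \<alpha> u * (\<Prod>w\<in>V - {u}. \<delta> w ^ \<alpha> w)" if "u \<in> V" for \<alpha> u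
    unfolding D_def using V that by (rule prod.remove)
  have D_Suc: "D (\<alpha>(u := Suc (\<alpha> u))) = \<delta> u * D \<alpha>" if "u \<in> V" for \<alpha> u
  proof -
    have "(\<Prod>w\<in>V - {u}. \<delta> w ^ (\<alpha>(u := Suc (\<alpha> u))) w) = (\<Prod>w\<in>V - {u}. \<delta> w ^ \<alpha> w)"
      by (intro prod.cong) auto
    then show ?thesis
      unfolding D_split[OF that] by (simp add: mult.assoc)
  qed
  have size_Suc: "(\<Sum>w\<in>V. (\<alpha>(u := Suc (\<alpha> u))) w) = Suc (\<Sum>w\<in>V. \<alpha> w)" if "u \<in> V" for \<alpha> u
  proof -
    have "(\<Sum>w\<in>V - {u}. (\<alpha>(u := Suc (\<alpha> u))) w) = (\<Sum>w\<in>V - {u}. \<alpha> w)"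
      by (intro sum.cong) auto
    then show ?thesis
      using V that by (simp add: sum.remove[of V u])
  qed
  have "D \<alpha> \<in> I" if "0 < (\<Sum>u\<in>V. \<alpha> u)" "card V * Q < (\<Sum>u\<in>V. \<alpha> u) + n" for n \<alpha>
    using that
  proof (induction n arbitrary: \<alpha>)
    case 0
    have "\<exists>u\<in>V. Q \<le> \<alpha> u"
    proof (rule ccontr)
      assume "\<not> (\<exists>u\<in>V. Q \<le> \<alpha> u)"
      then have "(\<Sum>u\<in>V. \<alpha> u) \<le> (\<Sum>u\<in>V. Q)"
        by (intro sum_mono) auto
      with 0 show False
        by simp
    qed
    then obtain u where u: "u \<in> V" "Q \<le> \<alpha> u"
      by blast
    have "D (\<alpha>(u := 0)) * \<delta> u ^ \<alpha> u \<in> I"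
      using u \<delta> by (intro ideal_mult[OF I] ideal_power_le[OF I nil] D_vars)
    moreover have "D \<alpha> = D (\<alpha>(u := 0)) * \<delta> u ^ \<alpha> u"
    proof -
      have "(\<Prod>w\<in>V - {u}. \<delta> w ^ (\<alpha>(u := 0)) w) = (\<Prod>w\<in>V - {u}. \<delta> w ^ \<alpha> w)"
        by (intro prod.cong) auto
      then show ?thesis
        using D_split[OF u(1)] by (simp add: mult.commute)
    qed
    ultimately show ?case
      by simp
  next
    case (Suc n)
    obtain u where u: "u \<in> V" "0 < \<alpha> u"
      using Suc.prems(1) by (metis gr0I sum.neutral less_irrefl)
    define \<beta> where "\<beta> = \<alpha>(u := \<alpha> u - 1)"
    have \<alpha>: "\<alpha> = \<beta>(u := Suc (\<beta> u))"
      using u by (auto simp: \<beta>_def)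
    obtain i h where ih: "i \<in> I" "\<forall>p\<in>V \<times> V. vars (h p) \<subseteq> V"
      and \<delta>u: "\<delta> u = i + (\<Sum>p\<in>V \<times> V. h p * (case p of (u, w) \<Rightarrow> \<delta> u * \<delta> w))"
      using sq[OF u(1)] unfolding ideal_plus_def gen_ideal_def by blast
    have "h p * (case p of (x, y) \<Rightarrow> \<delta> x * \<delta> y) * D \<beta> \<in> I" if p: "p \<in> V \<times> V" for p
    proof -
      obtain x y where xy: "p = (x, y)" "x \<in> V" "y \<in> V"
        using p by auto
      let ?\<gamma> = "\<beta>(y := Suc (\<beta> y))"
      have "D (?\<gamma>(x := Suc (?\<gamma> x))) \<in> I"
      proof (rule Suc.IH)
        have "(\<Sum>w\<in>V. (?\<gamma>(x := Suc (?\<gamma> x))) w) = Suc (Suc (\<Sum>w\<in>V. \<beta> w))"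
          using xy by (simp only: size_Suc)
        moreover have "(\<Sum>w\<in>V. \<alpha> w) = Suc (\<Sum>w\<in>V. \<beta> w)"
          unfolding \<alpha> using u by (simp only: size_Suc)
        ultimately show "0 < (\<Sum>w\<in>V. (?\<gamma>(x := Suc (?\<gamma> x))) w)"
          "card V * Q < (\<Sum>w\<in>V. (?\<gamma>(x := Suc (?\<gamma> x))) w) + n"
          using Suc.prems(2) by simp_all
      qed
      then have "\<delta> x * (\<delta> y * D \<beta>) \<in> I"
        using xy by (simp only: D_Suc)
      then have "h p * (\<delta> x * (\<delta> y * D \<beta>)) \<in> I"
        by (rule ideal_mult[OF I]) (use ih(2) p in blast)
      then show ?thesis
        by (simp add: xy mult.assoc)
    qed
    then have "(\<Sum>p\<in>V \<times> V. h p * (case p of (u, w) \<Rightarrow> \<delta> u * \<delta> w) * D \<beta>) \<in> I"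
      by (rule ideal_sum[OF I])
    moreover have "D \<alpha> = i * D \<beta> + (\<Sum>p\<in>V \<times> V. h p * (case p of (u, w) \<Rightarrow> \<delta> u * \<delta> w) * D \<beta>)"
      unfolding \<alpha> D_Suc[OF u(1)] \<delta>u distrib_right sum_distrib_right ..
    ultimately show ?case
      using ih(1) D_vars by (simp add: ideal_add[OF I] ideal_mult_right[OF I])
  qed
  from this[of "(\<lambda>_. 0)(v := 1)" "card V * Q"] have "D ((\<lambda>_. 0)(v := 1)) \<in> I"
    using size_Suc[OF v, of "\<lambda>_. 0"] by simp
  moreover have "D ((\<lambda>_. 0)(v := 1)) = \<delta> v"
    using D_Suc[OF v, of "\<lambda>_. 0"] by (simp add: D_def[of "\<lambda>_. 0"])
  ultimately show ?thesis
    by simp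
qed

context rewriting_system
begin

text \<open>
  The iterates of the Frobenius map on the finite quotient ring form a finite semigroup, which contains
  an idempotent.
\<close>

lemma frobenius_stable:
  obtains N where "0 < N"
    "\<And>f. vars f \<subseteq> V \<Longrightarrow> f ^ (CHAR('a) ^ N) - f ^ (CHAR('a) ^ N * CHAR('a) ^ N) \<in> ideal_of V"
proof -
  note ideal_of = ideal_of_is_ideal[OF subset_refl]
  let ?p = "CHAR('a)"
  define B where "B = (polys V (card V * (d - 1)) :: 'a mpoly set)"
  have B: "finite B" "\<And>b. b \<in> B \<Longrightarrow> vars b \<subseteq> V"
    unfolding B_def using finite_polys[OF finite_V] polys_vars by blast+
  have "\<forall>f. \<exists>b. vars f \<subseteq> V \<longrightarrow> b \<in> B \<and> f - b \<in> ideal_of V"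
    using reduced_representative unfolding B_def by metis
  then obtain rep where rep: "\<And>f. vars f \<subseteq> V \<Longrightarrow> rep f \<in> B \<and> f - rep f \<in> ideal_of V"
    by metis
  \<comment> \<open>The iterate number \<open>n\<close> of the Frobenius map on the quotient, on representatives.\<close>
  define \<Phi> where "\<Phi> n = restrict (\<lambda>b. rep (b ^ (?p ^ n))) B" for n
  have "range \<Phi> \<subseteq> B \<rightarrow>\<^sub>E B"
    using rep[OF vars_power_subset[OF B(2)]] by (auto simp: \<Phi>_def)
  then have "finite (range \<Phi>)"
    by (rule finite_subset) (intro finite_PiE B)
  then have "\<not> inj \<Phi>"
    using finite_imageD infinite_UNIV_nat by blast
  then obtain i j where ij: "i < j" "\<Phi> i = \<Phi> j"
    unfolding inj_on_def by (metis nat_neq_iff)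
  define c where "c = j - i"
  have step0: "f ^ (?p ^ i) - f ^ (?p ^ (i + c)) \<in> ideal_of V" if f: "vars f \<subseteq> V" for f
  proof -
    let ?b = "rep f"
    have b: "?b \<in> B" "f - ?b \<in> ideal_of V" "vars ?b \<subseteq> V"
      using rep[OF f] B by auto
    have "rep (?b ^ (?p ^ i)) = rep (?b ^ (?p ^ j))"
      using fun_cong[OF ij(2), of ?b] b by (simp add: \<Phi>_def)
    then have "?b ^ (?p ^ i) - ?b ^ (?p ^ j) \<in> ideal_of V"
      using rep[of "?b ^ (?p ^ i)"] rep[of "?b ^ (?p ^ j)"] b(3) vars_power_subset
        ideal_cong_trans[OF ideal_of] ideal_cong_sym[OF ideal_of] by metis
    moreover have "f ^ k - ?b ^ k \<in> ideal_of V" for k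
      using b f by (intro ideal_cong_power[OF ideal_of])
    ultimately show ?thesis
      using ideal_cong_trans[OF ideal_of] ideal_cong_sym[OF ideal_of] ij(1) unfolding c_def
      by (metis add_diff_inverse_nat less_imp_le linorder_not_less)
  qed
  have step1: "f ^ (?p ^ n) - f ^ (?p ^ (n + c)) \<in> ideal_of V" if f: "vars f \<subseteq> V" and n: "i \<le> n" for f n
  proof -
    have "(f ^ (?p ^ (n - i))) ^ (?p ^ i) - (f ^ (?p ^ (n - i))) ^ (?p ^ (i + c)) \<in> ideal_of V"
      by (intro step0 vars_power_subset f)
    then show ?thesis
      using n by (simp add: power_mult[symmetric] power_add[symmetric])
  qed
  have step: "f ^ (?p ^ n) - f ^ (?p ^ (n + k * c)) \<in> ideal_of V" if f: "vars f \<subseteq> V" and n: "i \<le> n" for f n k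
  proof (induction k)
    case (Suc k)
    have "f ^ (?p ^ (n + k * c)) - f ^ (?p ^ (n + k * c + c)) \<in> ideal_of V"
      using n by (intro step1 f) simp
    with Suc have "f ^ (?p ^ n) - f ^ (?p ^ (n + k * c + c)) \<in> ideal_of V"
      by (rule ideal_cong_trans[OF ideal_of])
    then show ?case
      by (simp add: ac_simps)
  qed (simp add: ideal_0[OF ideal_of])
  have c: "0 < c"
    using ij by (simp add: c_def)
  then have "i \<le> Suc i * c"
    by (metis le_SucI le_refl mult.commute mult_le_mono1 nat_mult_1 Suc_leI One_nat_def le_trans)
  show ?thesis
  proof (rule that)
    show "0 < Suc i * c"
      using c by simp
    show "f ^ (?p ^ (Suc i * c)) - f ^ (?p ^ (Suc i * c) * ?p ^ (Suc i * c)) \<in> ideal_of V" if f: "vars f \<subseteq> V" for f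
      using step[OF f \<open>i \<le> Suc i * c\<close>, of "Suc i"] by (simp add: power_add)
  qed
qed

lemma Const_in_ideal_of: "Const c \<in> ideal_of V \<Longrightarrow> c = 0"
proof (rule ccontr)
  assume c: "Const c \<in> ideal_of V" "c \<noteq> 0"
  have "Const (inverse c) * Const c \<in> ideal_of V"
    using c(1) by (intro ideal_mult[OF ideal_of_is_ideal]) auto
  then show False
    using one_notin_ideal_of[of V] c(2) by (simp add: Const_mult[symmetric])
qed

text \<open>
  The assumption gives the Jacobian matrix of \<open>G\<close> a left inverse modulo \<open>G\<close>.  Let \<open>\<delta>\<^sub>v = X\<^sub>v - X\<^sub>v\<^sup>Q\<close> with
  \<open>Q\<close> as in \<open>frobenius_stable\<close>.  The Taylor formula for \<open>G\<^sub>j - G\<^sub>j\<^sup>Q\<close>, which vanishes modulo \<open>G\<close>, says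
  that the Jacobian matrix sends the vector \<open>\<delta>\<close> to something of second order in \<open>\<delta>\<close>.  So \<open>\<delta>\<close> is
  itself of second order, and being nilpotent it vanishes modulo \<open>G\<close>.  Then \<open>f\<close> and \<open>f\<^sup>Q\<close> agree modulo
  \<open>G\<close> for every \<open>f\<close>, and a nilpotent \<open>f\<close> is zero.
\<close>

lemma jacobian_radical_closed:
  assumes jac: "\<And>l. l \<in> V \<Longrightarrow> \<exists>c. (\<forall>j\<in>V. vars (c j) \<subseteq> V) \<and>
    (\<forall>m\<in>V. (\<Sum>j\<in>V. c j * pd m (G j)) - (if m = l then 1 else 0) \<in> ideal_of V)"
  shows "radical_closed V"
proof -
  note ideal_of = ideal_of_is_ideal[OF subset_refl]
  let ?p = "CHAR('a)"
  obtain N where N: "0 < N"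
    "\<And>f. vars f \<subseteq> V \<Longrightarrow> f ^ (?p ^ N) - f ^ (?p ^ N * ?p ^ N) \<in> ideal_of V"
    using frobenius_stable by blast
  define Q where "Q = ?p ^ N"
  have stable: "f ^ Q - (f ^ Q) ^ Q \<in> ideal_of V" if "vars f \<subseteq> V" for f
    using N(2)[OF that] by (simp add: Q_def power_mult)
  have "1 < ?p"
    using prime_CHAR_field prime_gt_1_nat by blast
  then have Q1: "1 < Q"
    unfolding Q_def using N(1) by (metis one_less_power)
  \<comment> \<open>Constants are distinct modulo \<open>G\<close>, and the Frobenius map is injective on them, so its idempotent
    power fixes them.\<close>
  have fermat: "c ^ Q = c" for c :: 'a
  proof -
    have "Const (c ^ Q - (c ^ Q) ^ Q) \<in> ideal_of V"
    proof -
      have "Const (c ^ Q - (c ^ Q) ^ Q) = Const c ^ Q - (Const c ^ Q) ^ Q"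
        by (simp only: Const_power Const_diff)
      then show ?thesis
        using stable[of "Const c"] by simp
    qed
    then have "(c ^ Q) ^ Q = c ^ Q"
      using Const_in_ideal_of by fastforce
    moreover have "((c ^ Q - c) + c) ^ Q = (c ^ Q - c) ^ Q + c ^ Q"
      by (rule freshmans_dream'[OF prime_CHAR_field Q_def])
    ultimately have "(c ^ Q - c) ^ Q = 0"
      by simp
    then show ?thesis
      by simp
  qed
  define \<delta> where "\<delta> v = frob_diff Q (Var v :: 'a mpoly)" for v
  have \<delta>_vars: "vars (\<delta> v) \<subseteq> V" if "v \<in> V" for v
    unfolding \<delta>_def using that by (intro frob_diff_vars) simp
  note taylor = frobenius_taylor[OF finite_V Q_def fermat]
  let ?J = "ideal_plus (ideal_of V) (frob_diff_square V Q)"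
  note J = is_ideal_plus[OF ideal_of is_ideal_frob_diff_square[of V Q]]
  have jac_row: "(\<Sum>m\<in>V. pd m (G j) * \<delta> m) \<in> ?J" if j: "j \<in> V" for j
  proof -
    have "G j \<in> ideal_of V"
      using j by (intro gen_ideal_generator) auto
    moreover from this have "G j ^ Q \<in> ideal_of V"
      using ideal_power_le[OF ideal_of, of "G j" 1 Q] Q1 G_vars[OF j] by simp
    ultimately have "frob_diff Q (G j) \<in> ideal_of V"
      unfolding frob_diff_def by (rule ideal_diff[OF ideal_of])
    then have "frob_diff Q (G j) \<in> ?J"
      by (rule ideal_plus_left[OF is_ideal_frob_diff_square])
    moreover have "frob_diff Q (G j) - (\<Sum>m\<in>V. pd m (G j) * \<delta> m) \<in> ?J"
      unfolding \<delta>_def by (intro ideal_plus_right[OF ideal_of] taylor G_vars j)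
    ultimately show ?thesis
      using ideal_cong[OF J] by blast
  qed
  have sq: "\<delta> l \<in> ?J" if l: "l \<in> V" for l
  proof -
    obtain c where c: "\<forall>j\<in>V. vars (c j) \<subseteq> V"
      "\<forall>m\<in>V. (\<Sum>j\<in>V. c j * pd m (G j)) - (if m = l then 1 else 0) \<in> ideal_of V"
      using jac[OF l] by blast
    have 1: "(\<Sum>j\<in>V. c j * (\<Sum>m\<in>V. pd m (G j) * \<delta> m)) \<in> ?J"
      using c by (intro ideal_sum[OF J] ideal_mult[OF J] jac_row) auto
    have 2: "(\<Sum>m\<in>V. ((\<Sum>j\<in>V. c j * pd m (G j)) - (if m = l then 1 else 0)) * \<delta> m) \<in> ideal_of V"
      using c \<delta>_vars by (intro ideal_sum[OF ideal_of] ideal_mult_right[OF ideal_of]) auto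
    have "(\<Sum>m\<in>V. (if m = l then 1 else 0) * \<delta> m) = (\<Sum>m\<in>V. if m = l then \<delta> m else 0)"
      by (intro sum.cong) auto
    also have "\<dots> = \<delta> l"
      using l by simp
    finally have "(\<Sum>m\<in>V. ((\<Sum>j\<in>V. c j * pd m (G j)) - (if m = l then 1 else 0)) * \<delta> m)
      = (\<Sum>m\<in>V. \<Sum>j\<in>V. c j * pd m (G j) * \<delta> m) - \<delta> l"
      by (simp add: left_diff_distrib sum_subtractf sum_distrib_right)
    also have "(\<Sum>m\<in>V. \<Sum>j\<in>V. c j * pd m (G j) * \<delta> m) = (\<Sum>j\<in>V. c j * (\<Sum>m\<in>V. pd m (G j) * \<delta> m))"
      by (subst sum.swap) (simp add: sum_distrib_left mult.assoc)
    finally have "(\<Sum>j\<in>V. c j * (\<Sum>m\<in>V. pd m (G j) * \<delta> m)) - \<delta> l \<in> ideal_of V"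
      using 2 by simp
    then have "(\<Sum>j\<in>V. c j * (\<Sum>m\<in>V. pd m (G j) * \<delta> m)) - \<delta> l \<in> ?J"
      by (rule ideal_plus_left[OF is_ideal_frob_diff_square])
    then show ?thesis
      using 1 ideal_cong[OF J] by blast
  qed
  have \<delta>_ideal_of: "\<delta> v \<in> ideal_of V" if "v \<in> V" for v
  proof (rule nilpotent_absorb[OF ideal_of finite_V \<delta>_vars _ _ that])
    show "\<delta> v ^ Q \<in> ideal_of V" if v: "v \<in> V" for v
    proof -
      have "((Var v - Var v ^ Q :: 'a mpoly) + Var v ^ Q) ^ Q = (Var v - Var v ^ Q) ^ Q + (Var v ^ Q) ^ Q"
        by (rule frobenius_add[OF Q_def])
      then have "\<delta> v ^ Q = Var v ^ Q - (Var v ^ Q) ^ Q"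
        unfolding \<delta>_def frob_diff_def diff_add_cancel by (metis add_diff_cancel_right')
      then show ?thesis
        using stable[of "Var v"] v by simp
    qed
    show "\<delta> v \<in> ideal_plus (ideal_of V) (gen_ideal V (\<lambda>(u, w). \<delta> u * \<delta> w) (V \<times> V))" if "v \<in> V" for v
      using sq[OF that] by (simp add: frob_diff_square_def \<delta>_def)
  qed
  have "frob_diff_square V Q \<subseteq> ideal_of V"
    unfolding frob_diff_square_def using \<delta>_ideal_of \<delta>_vars
    by (intro gen_ideal_least[OF ideal_of]) (auto simp: \<delta>_def intro!: ideal_mult[OF ideal_of])
  then have frob_ideal_of: "f - f ^ Q \<in> ideal_of V" if f: "vars f \<subseteq> V" for f
  proof -
    have "frob_diff Q f - (\<Sum>l\<in>V. pd l f * \<delta> l) \<in> ideal_of V"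
      unfolding \<delta>_def using taylor[OF f] \<open>frob_diff_square V Q \<subseteq> ideal_of V\<close> by blast
    moreover have "(\<Sum>l\<in>V. pd l f * \<delta> l) \<in> ideal_of V"
      using f by (intro ideal_sum[OF ideal_of] ideal_mult[OF ideal_of] \<delta>_ideal_of pd_vars)
    ultimately show ?thesis
      using ideal_cong[OF ideal_of] unfolding frob_diff_def by blast
  qed
  show ?thesis
    unfolding radical_closed_def
  proof (intro allI impI)
    fix f n assume f: "vars f \<subseteq> V" "f ^ n \<in> ideal_of V"
    have "f - f ^ (Q ^ k) \<in> ideal_of V" for k
    proof (induction k)
      case (Suc k)
      have "f ^ (Q ^ k) - (f ^ (Q ^ k)) ^ Q \<in> ideal_of V"
        by (intro frob_ideal_of vars_power_subset f)
      with Suc show ?case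
        using ideal_cong_trans[OF ideal_of] by (metis power_Suc2 power_mult)
    qed (simp add: ideal_0[OF ideal_of])
    moreover have "f ^ (Q ^ n) \<in> ideal_of V"
      using Q1 f by (intro ideal_power_le[OF ideal_of f(2)]) (simp_all add: less_imp_le power_gt_expt)
    ultimately show "f \<in> ideal_of V"
      using ideal_cong[OF ideal_of] by blast
  qed
qed

end

section \<open>Coefficient families of rewriting and of the Jacobian\<close>

text \<open>
  The row with index \<open>(j, m)\<close> is the tuple with entries \<open>jac_row V d G j m l\<close>, \<open>l \<in> V\<close>.  For a reduced
  monomial \<open>m\<close> it is \<open>X\<^sup>m\<close> times the \<open>j\<close>-th row of the Jacobian matrix, and otherwise it has a multiple of
  some \<open>G\<^sub>v\<close> in place \<open>j\<close> and zeros elsewhere.  So the span of all rows consists of tuples that are,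
  modulo \<open>G\<close>, combinations of the rows of the Jacobian matrix.  Every row is linear in \<open>G\<close>.
\<close>

definition jac_row ::
  "nat set \<Rightarrow> nat \<Rightarrow> (nat \<Rightarrow> 'a::comm_ring_1 mpoly) \<Rightarrow> nat \<Rightarrow> monomial \<Rightarrow> nat \<Rightarrow> 'a mpoly" where
  "jac_row V d G j m l =
     (if reduced V d m then mon m * pd l (G j) else if l = j then rewrite_row V d G m else 0)"

definition jac_coeff ::
  "nat set \<Rightarrow> nat \<Rightarrow> (nat \<Rightarrow> 'a::comm_ring_1 mpoly) \<Rightarrow> nat \<times> monomial \<Rightarrow> nat \<times> monomial \<Rightarrow> 'a" where
  "jac_coeff V d G = (\<lambda>(j, m) (l, k). if l \<in> V then lookup (jac_row V d G j m l) k else 0)"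

lemma rewrite_row_cong:
  assumes "\<And>v. v \<in> V \<Longrightarrow> G v = G' v"
  shows "rewrite_row V d G m = rewrite_row V d G' m"
  using assms pivot_split(1)[of V d m] by (simp add: rewrite_row_def)

lemma jac_coeff_cong:
  assumes "\<And>v. v \<in> V \<Longrightarrow> G v = G' v" "fst p \<in> V"
  shows "jac_coeff V d G p = jac_coeff V d G' p"
  using assms rewrite_row_cong[OF assms(1)]
  by (auto simp: jac_coeff_def jac_row_def fun_eq_iff split: prod.splits)

text \<open>
  For such \<open>H\<close> the row of a monomial is this monomial plus terms of smaller degree, so the rows form a
  triangular matrix.
\<close>

lemma indep_rewrite_perturbed_powers:
  fixes H :: "nat \<Rightarrow> 'a::{field,finite} mpoly"
  assumes V: "finite V" and d: "0 < d"
    and H: "\<And>v. v \<in> V \<Longrightarrow> H v - mon (vpow v d) \<in> polys V (d - 1)"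
  shows "indep (\<lambda>m. lookup (rewrite_row V d H m)) (monoms V t)"
proof -
  have top: "lookup (rewrite_row V d H n) m = (if n = m then 1 else 0)"
    if m: "m \<in> monoms V t" and n: "n \<in> monoms V t" and le: "mono_degree n \<le> mono_degree m" for m n
  proof -
    have "n \<in> monoms V (mono_degree n)"
      using n by (simp add: monoms_def)
    then show ?thesis
    proof (cases rule: pivot_cases[where d = d])
      case 1
      then show ?thesis
        by (simp add: rewrite_row_def lookup_single)
    next
      case (2 k)
      let ?L = "H (pivot V d n) - mon (vpow (pivot V d n) d)"
      have "rewrite_row V d H n = mon k * mon (vpow (pivot V d n) d) + mon k * ?L"
        using 2 by (simp add: rewrite_row_def algebra_simps)
      also have "mon k * mon (vpow (pivot V d n) d) = (mon n :: 'a mpoly)"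
        by (subst (2) 2(3)) (rule mon_mult[symmetric])
      finally have eq: "rewrite_row V d H n = mon n + mon k * ?L" .
      have "mon k * ?L \<in> polys V ((mono_degree n - d) + (d - 1))"
        using 2 H by (intro polys_mult) simp_all
      moreover have "m \<notin> monoms V ((mono_degree n - d) + (d - 1))"
      proof -
        have "(mono_degree n - d) + (d - 1) < mono_degree m"
          using le 2(5) d by linarith
        then show ?thesis
          by (simp add: monoms_def)
      qed
      ultimately have "lookup (mon k * ?L) m = 0"
        unfolding polys_def by (auto simp: in_keys_iff)
      then show ?thesis
        unfolding eq by (simp add: lookup_add lookup_single)
    qed
  qed
  show ?thesis
    unfolding indep_def
  proof (intro allI impI ballI, rule ccontr)
    fix x n assume *: "\<forall>k. (\<Sum>m\<in>monoms V t. x m * lookup (rewrite_row V d H m) k) = 0"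
      and n: "n \<in> monoms V t" "x n \<noteq> 0"
    let ?N = "{m \<in> monoms V t. x m \<noteq> 0}"
    have fin: "finite ?N"
      using finite_monoms[OF V] by simp
    \<comment> \<open>A monomial of maximal degree in the relation occurs in its own row and in no other row.\<close>
    define D where "D = Max (mono_degree ` ?N)"
    have "D \<in> mono_degree ` ?N"
      unfolding D_def using fin n by (intro Max_in) auto
    then obtain m where m: "m \<in> monoms V t" "x m \<noteq> 0" "mono_degree m = D"
      by auto
    have "x k * lookup (rewrite_row V d H k) m = (if k = m then x m else 0)" if k: "k \<in> monoms V t" for k
    proof (cases "x k = 0")
      case False
      then have "mono_degree k \<le> mono_degree m"
        unfolding m(3) D_def using fin k by (intro Max_ge) auto
      from top[OF m(1) k this] show ?thesis
        by simp
    qed (use m in auto)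
    then have "(\<Sum>k\<in>monoms V t. x k * lookup (rewrite_row V d H k) m) = (\<Sum>k\<in>monoms V t. if k = m then x m else 0)"
      by (intro sum.cong) auto
    also have "\<dots> = x m"
      using m(1) finite_monoms[OF V] by simp
    finally show False
      using * m(2) by simp
  qed
qed

text \<open>
  In the direction \<open>X\<^sub>v\<^sup>d\<close> the coefficient of \<open>c\<close> in the row of a nonreduced monomial is this monomial
  itself.  The rows of reduced monomials do not depend on \<open>c\<close>; they are scaled by \<open>c\<close>, which changes
  independence only for \<open>c = 0\<close>, to obtain a pencil \<open>a + c b\<close> where \<open>b\<close> is the monomial basis.
\<close>

lemma card_bad_rewrite_le:
  fixes G :: "nat \<Rightarrow> 'a::{field,finite} mpoly"
  assumes V: "finite V" and d: "0 < d"
  shows "card {c. \<not> indep (\<lambda>m. lookup (rewrite_row V d (\<lambda>v. G v + Const c * mon (vpow v d)) m)) (monoms V t)}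
    \<le> card (monoms V t)"
proof -
  let ?M = "monoms V t"
  let ?R = "\<lambda>c m. rewrite_row V d (\<lambda>v. G v + Const c * mon (vpow v d)) m"
  define a where "a m k = (if reduced V d m then 0 else lookup (rewrite_row V d G m) k)" for m k
  define b where "b m = lookup (mon m :: 'a mpoly)" for m :: monomial
  have row: "a m k + c * b m k = (if reduced V d m then c else 1) * lookup (?R c m) k" for c m k
  proof (cases "reduced V d m")
    case True
    then show ?thesis
      by (simp add: a_def b_def rewrite_row_def)
  next
    case False
    let ?n = "m - vpow (pivot V d m) d"
    have "?R c m = mon ?n * G (pivot V d m) + Const c * (mon ?n * mon (vpow (pivot V d m) d))"
      using False by (simp add: rewrite_row_def algebra_simps)
    also have "mon ?n * mon (vpow (pivot V d m) d) = (mon m :: 'a mpoly)"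
      by (subst (2) pivot_split(2)[OF False]) (rule mon_mult[symmetric])
    finally show ?thesis
      using False by (simp add: a_def b_def lookup_add rewrite_row_def)
  qed
  have "indep b ?M"
    unfolding indep_def
  proof (intro allI impI ballI)
    fix x m assume *: "\<forall>k. (\<Sum>m\<in>?M. x m * b m k) = 0" and m: "m \<in> ?M"
    have "(\<Sum>n\<in>?M. x n * b n m) = (\<Sum>n\<in>?M. if n = m then x m else 0)"
      by (intro sum.cong) (auto simp: b_def lookup_single)
    then show "x m = 0"
      using * m finite_monoms[OF V] by simp
  qed
  then have "card {c. \<not> indep (\<lambda>m k. a m k + c * b m k) ?M} \<le> card ?M"
    by (rule card_dependent_pencil_le) (simp add: finite_monoms V)
  moreover have "indep (\<lambda>m. lookup (?R c m)) ?M" if ind: "indep (\<lambda>m k. a m k + c * b m k) ?M" for c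
  proof -
    have red0: "reduced V d 0"
      using d by (simp add: reduced_def)
    \<comment> \<open>The row of the monomial 1 in the pencil is \<open>c\<close> times this monomial.\<close>
    have c: "c \<noteq> 0"
    proof
      assume "c = 0"
      then have "(\<Sum>m\<in>?M. (if m = 0 then 1 else 0) * (a m k + c * b m k)) = 0" for k
        by (intro sum.neutral) (auto simp: a_def red0)
      from indepD[OF ind this, of 0] show False
        by simp
    qed
    show ?thesis
      unfolding indep_def
    proof (intro allI impI ballI)
      fix x m assume *: "\<forall>k. (\<Sum>m\<in>?M. x m * lookup (?R c m) k) = 0" and m: "m \<in> ?M"
      let ?y = "\<lambda>m. if reduced V d m then x m / c else x m"
      have "(\<Sum>m\<in>?M. ?y m * (a m k + c * b m k)) = (\<Sum>m\<in>?M. x m * lookup (?R c m) k)" for k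
        unfolding row using c by (intro sum.cong) auto
      then have "?y m = 0"
        using indepD[OF ind, of ?y m] * m by simp
      then show "x m = 0"
        using c by (simp split: if_splits)
    qed
  qed
  then have "{c. \<not> indep (\<lambda>m. lookup (?R c m)) ?M} \<subseteq> {c. \<not> indep (\<lambda>m k. a m k + c * b m k) ?M}"
    by blast
  then have "card {c. \<not> indep (\<lambda>m. lookup (?R c m)) ?M} \<le> card {c. \<not> indep (\<lambda>m k. a m k + c * b m k) ?M}"
    by (rule card_mono[rotated]) simp
  ultimately show ?thesis
    by linarith
qed

lemma jac_row_add:
  "jac_row V d (\<lambda>v. G v + Const c * H v) j m l = jac_row V d G j m l + Const c * jac_row V d H j m l"
  by (simp add: jac_row_def rewrite_row_def pd_add pd_Const_mult algebra_simps)

lemma card_bad_jac_le: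
  fixes G H :: "nat \<Rightarrow> 'a::{field,finite} mpoly"
  assumes V: "finite V" and H: "indep (jac_coeff V d H) (V \<times> monoms V t)"
  shows "card {c. \<not> indep (jac_coeff V d (\<lambda>v. G v + Const c * H v)) (V \<times> monoms V t)}
    \<le> card V * card (monoms V t)"
proof -
  have "jac_coeff V d (\<lambda>v. G v + Const c * H v)
      = (\<lambda>p k. jac_coeff V d G p k + c * jac_coeff V d H p k)" for c
    by (auto simp: jac_coeff_def fun_eq_iff jac_row_add lookup_add)
  moreover have "finite (V \<times> monoms V t)"
    using V by (simp add: finite_monoms)
  ultimately show ?thesis
    using card_dependent_pencil_le[OF H, of "jac_coeff V d G"] by (simp add: card_cartesian_product)
qed

context rewriting_system
begin

lemma nonreduced_row_in_ideal_of: "\<not> reduced V d m \<Longrightarrow> m \<in> monoms V e \<Longrightarrow> rewrite_row V d G m \<in> ideal_of V"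
proof -
  assume m: "\<not> reduced V d m" "m \<in> monoms V e"
  from m(2) show ?thesis
  proof (cases rule: pivot_cases[where d = d])
    case (2 n)
    have "mon n * G (pivot V d m) \<in> ideal_of V"
      using 2 by (intro ideal_mult[OF ideal_of_is_ideal[OF subset_refl]] gen_ideal_generator)
        (auto simp: vars_mon monoms_def)
    with 2 show ?thesis
      by (simp add: rewrite_row_def)
  qed (use m in simp)
qed

lemma jac_row_polys:
  assumes "j \<in> V" "m \<in> monoms V t" "(card V + 1) * (d - 1) \<le> t"
  shows "jac_row V d G j m l \<in> polys V t"
proof (cases "reduced V d m")
  case True
  have "m \<in> monoms V (card V * (d - 1))"
    using assms(2) reduced_degree_le[OF finite_V True] by (simp add: monoms_def)
  then have "mon m * pd l (G j) \<in> polys V (card V * (d - 1) + (d - 1))"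
    using assms(1) by (intro polys_mult pd_polys G_polys) simp_all
  moreover have "(card V + 1) * (d - 1) = card V * (d - 1) + (d - 1)"
    by simp
  then have "card V * (d - 1) + (d - 1) \<le> t"
    using assms(3) by linarith
  ultimately have "mon m * pd l (G j) \<in> polys V t"
    using polys_mono by blast
  with True show ?thesis
    by (simp add: jac_row_def)
qed (use assms rewrite_row_polys in \<open>simp add: jac_row_def\<close>)

text \<open>
  There are as many rows as coefficients in tuples of polynomials of degree at most \<open>t\<close>, and \<open>t\<close> is an
  upper bound for the degrees of the rows.  So independent rows span, and in particular the unit vectors
  are combinations of them.  The coefficients of such combinations form a left inverse of the Jacobian
  matrix.
\<close>

lemma radical_closed_of_indep_jac:
  assumes t2: "(card V + 1) * (d - 1) \<le> t"
    and ind: "indep (jac_coeff V d G) (V \<times> monoms V t)"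
  shows "radical_closed V"
proof (rule jacobian_radical_closed)
  fix l0 assume l0: "l0 \<in> V"
  let ?M = "monoms V t"
  note ideal_of = ideal_of_is_ideal[OF subset_refl]
  define y where "y = (\<lambda>(l, k). if l = l0 \<and> k = (0 :: monomial) then 1 else 0 :: 'a)"
  have fin: "finite (V \<times> ?M)" "finite ?M"
    by (simp_all add: finite_monoms)
  obtain x where x: "\<And>p. (\<Sum>i\<in>V \<times> ?M. x i * jac_coeff V d G i p) = y p"
  proof (rule indep_spanning[OF ind fin(1) fin(1)])
    show "jac_coeff V d G i p = 0" if i: "i \<in> V \<times> ?M" and p: "p \<notin> V \<times> ?M" for i p
    proof -
      obtain j m where jm: "i = (j, m)" "j \<in> V" "m \<in> ?M"
        using i by auto
      obtain l k where lk: "p = (l, k)"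
        by fastforce
      have "k \<notin> keys (jac_row V d G j m l)" if "l \<in> V"
        using jac_row_polys[OF jm(2,3) t2, of l] p lk that unfolding polys_def by blast
      then show ?thesis
        using jm lk by (auto simp: jac_coeff_def in_keys_iff)
    qed
    show "y p = 0" if "p \<notin> V \<times> ?M" for p
      using that l0 by (cases p) (auto simp: y_def)
  qed auto
  define c where "c j = (\<Sum>m\<in>{m \<in> ?M. reduced V d m}. Const (x (j, m)) * mon m)" for j
  have split: "(\<Sum>m\<in>?M. f m) = (\<Sum>m\<in>{m \<in> ?M. reduced V d m}. f m) + (\<Sum>m\<in>{m \<in> ?M. \<not> reduced V d m}. f m)"
    for f :: "monomial \<Rightarrow> 'a mpoly"
    unfolding sum.inter_filter[OF fin(2)] sum.distrib[symmetric] by (intro sum.cong) auto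
  have "(\<Sum>j\<in>V. c j * pd l (G j)) - (if l = l0 then 1 else 0) \<in> ideal_of V" if l: "l \<in> V" for l
  proof -
    have "(\<Sum>i\<in>V \<times> ?M. Const (x i) * jac_row V d G (fst i) (snd i) l) = (if l = l0 then 1 else 0)"
    proof (subst combination_eq, intro allI)
      fix k
      have "(\<Sum>i\<in>V \<times> ?M. x i * lookup (jac_row V d G (fst i) (snd i) l) k)
          = (\<Sum>i\<in>V \<times> ?M. x i * jac_coeff V d G i (l, k))"
        using l by (intro sum.cong) (auto simp: jac_coeff_def)
      also have "\<dots> = lookup (if l = l0 then 1 else 0) k"
        unfolding x by (auto simp: y_def lookup_one)
      finally show "(\<Sum>i\<in>V \<times> ?M. x i * lookup (jac_row V d G (fst i) (snd i) l) k)
          = lookup (if l = l0 then 1 else 0) k" .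
    qed
    also have "(\<Sum>i\<in>V \<times> ?M. Const (x i) * jac_row V d G (fst i) (snd i) l)
        = (\<Sum>j\<in>V. \<Sum>m\<in>?M. Const (x (j, m)) * jac_row V d G j m l)"
      by (subst sum.cartesian_product) (simp add: case_prod_unfold)
    also have "\<dots> = (\<Sum>j\<in>V. c j * pd l (G j)
        + (\<Sum>m\<in>{m \<in> ?M. \<not> reduced V d m}. Const (x (j, m)) * jac_row V d G j m l))"
      unfolding split c_def sum_distrib_right
      by (intro sum.cong refl arg_cong2[of _ _ _ _ "(+)"]) (simp_all add: jac_row_def mult.assoc)
    finally have "(if l = l0 then 1 else 0) = (\<Sum>j\<in>V. c j * pd l (G j)
        + (\<Sum>m\<in>{m \<in> ?M. \<not> reduced V d m}. Const (x (j, m)) * jac_row V d G j m l))"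
      by (rule sym)
    then have eq: "(\<Sum>j\<in>V. c j * pd l (G j)) - (if l = l0 then 1 else 0)
        = - (\<Sum>j\<in>V. \<Sum>m\<in>{m \<in> ?M. \<not> reduced V d m}. Const (x (j, m)) * jac_row V d G j m l)"
      by (simp only: sum.distrib diff_add_eq_diff_diff_swap) simp
    have "Const (x (j, m)) * jac_row V d G j m l \<in> ideal_of V" if "m \<in> ?M" "\<not> reduced V d m" for j m
      using that nonreduced_row_in_ideal_of[of m t]
      by (intro ideal_mult[OF ideal_of]) (auto simp: jac_row_def ideal_0[OF ideal_of])
    then show ?thesis
      unfolding eq by (intro ideal_uminus[OF ideal_of] ideal_sum[OF ideal_of]) auto
  qed
  moreover have "vars (c j) \<subseteq> V" for j
    unfolding c_def by (intro vars_sum_subset vars_mult_subset) (auto simp: vars_mon monoms_def)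
  ultimately show "\<exists>c. (\<forall>j\<in>V. vars (c j) \<subseteq> V) \<and>
      (\<forall>m\<in>V. (\<Sum>j\<in>V. c j * pd m (G j)) - (if m = l0 then 1 else 0) \<in> ideal_of V)"
    by blast
qed

text \<open>
  If the Jacobian matrix is diagonal, the components of the tuples can be treated separately.  A vanishing
  combination in component \<open>l\<close> has the form \<open>c \<partial>\<^sub>lG\<^sub>l + g = 0\<close>, where \<open>c\<close> is reduced and \<open>g\<close> lies in the
  ideal.  As \<open>\<partial>\<^sub>lG\<^sub>l\<close> is a unit modulo the ideal, \<open>c\<close> lies in the ideal and therefore vanishes; the rest is
  a relation between the rewriting rows.
\<close>

lemma indep_jac_of_diagonal:
  assumes diag: "\<And>j l. j \<in> V \<Longrightarrow> l \<in> V \<Longrightarrow> j \<noteq> l \<Longrightarrow> pd l (G j) = 0"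
    and unit: "\<And>l. l \<in> V \<Longrightarrow> \<exists>u. vars u \<subseteq> V \<and> u * pd l (G l) - 1 \<in> ideal_of V"
  shows "indep (jac_coeff V d G) (V \<times> monoms V t)"
  unfolding indep_def
proof (intro allI impI ballI)
  let ?M = "monoms V t"
  note ideal_of = ideal_of_is_ideal[OF subset_refl]
  fix x p assume *: "\<forall>p. (\<Sum>i\<in>V \<times> ?M. x i * jac_coeff V d G i p) = 0" and p: "p \<in> V \<times> ?M"
  obtain l m0 where lm: "p = (l, m0)" and l: "l \<in> V" and m0: "m0 \<in> ?M"
    using p by auto
  have fin: "finite ?M"
    by (simp add: finite_monoms)
  let ?row = "\<lambda>m. if reduced V d m then mon m * pd l (G l) else rewrite_row V d G m"
  have total: "(\<Sum>m\<in>?M. Const (x (l, m)) * ?row m) = 0"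
  proof (subst combination_eq, intro allI)
    fix k
    have "(\<Sum>i\<in>V \<times> ?M. x i * jac_coeff V d G i (l, k))
        = (\<Sum>j\<in>V. \<Sum>m\<in>?M. x (j, m) * lookup (jac_row V d G j m l) k)"
      using l by (subst sum.cartesian_product) (auto simp: jac_coeff_def intro!: sum.cong)
    also have "\<dots> = (\<Sum>j\<in>V. if j = l then \<Sum>m\<in>?M. x (l, m) * lookup (?row m) k else 0)"
      using diag l by (intro sum.cong) (auto simp: jac_row_def intro!: sum.cong sum.neutral)
    also have "\<dots> = (\<Sum>m\<in>?M. x (l, m) * lookup (?row m) k)"
      using l by simp
    finally show "(\<Sum>m\<in>?M. x (l, m) * lookup (?row m) k) = lookup 0 k"
      using * by simp
  qed
  have split: "(\<Sum>m\<in>?M. f m) = (\<Sum>m\<in>?M. if reduced V d m then f m else 0) + (\<Sum>m\<in>?M. if reduced V d m then 0 else f m)"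
    for f :: "monomial \<Rightarrow> 'a mpoly"
    unfolding sum.distrib[symmetric] by (intro sum.cong) auto
  have 0: "(\<Sum>m\<in>?M. if reduced V d m then Const (x (l, m)) * ?row m else 0)
      + (\<Sum>m\<in>?M. if reduced V d m then 0 else Const (x (l, m)) * ?row m) = 0"
    by (rule trans[OF split[symmetric] total])
  define c where "c = (\<Sum>m\<in>?M. if reduced V d m then Const (x (l, m)) * mon m else 0)"
  define g where "g = (\<Sum>m\<in>?M. if reduced V d m then 0 else Const (x (l, m)) * rewrite_row V d G m)"
  have cg: "c * pd l (G l) + g = 0"
  proof -
    have "c * pd l (G l) = (\<Sum>m\<in>?M. if reduced V d m then Const (x (l, m)) * ?row m else 0)"
      unfolding c_def sum_distrib_right by (intro sum.cong) (auto simp: mult.assoc)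
    moreover have "g = (\<Sum>m\<in>?M. if reduced V d m then 0 else Const (x (l, m)) * ?row m)"
      unfolding g_def by (intro sum.cong) auto
    ultimately show ?thesis
      using 0 by simp
  qed
  have lc: "lookup c m = (if m \<in> ?M \<and> reduced V d m then x (l, m) else 0)" for m
  proof -
    have "lookup c m = (\<Sum>n\<in>?M. if n = m then if reduced V d m then x (l, m) else 0 else 0)"
      unfolding c_def lookup_sum by (intro sum.cong) (auto simp: lookup_single)
    then show ?thesis
      using fin by simp
  qed
  have keys_c: "reduced V d m \<and> keys m \<subseteq> V" if "m \<in> keys c" for m
    using that by (auto simp: in_keys_iff lc monoms_def split: if_splits)
  have "g \<in> ideal_of V"
    unfolding g_def using nonreduced_row_in_ideal_of
    by (intro ideal_sum[OF ideal_of]) (auto intro!: ideal_mult[OF ideal_of] ideal_0[OF ideal_of])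
  then have cpd: "c * pd l (G l) \<in> ideal_of V"
    using cg ideal_uminus[OF ideal_of, of g] by (simp add: eq_neg_iff_add_eq_0[symmetric])
  obtain u where u: "vars u \<subseteq> V" "u * pd l (G l) - 1 \<in> ideal_of V"
    using unit[OF l] by blast
  have c_V: "vars c \<subseteq> V"
    using keys_c by (auto simp: vars_def)
  have "u * (c * pd l (G l)) - c * (u * pd l (G l) - 1) \<in> ideal_of V"
    by (rule ideal_diff[OF ideal_of ideal_mult[OF ideal_of cpd u(1)] ideal_mult[OF ideal_of u(2) c_V]])
  moreover have "u * (c * pd l (G l)) - c * (u * pd l (G l) - 1) = c"
    by (simp add: algebra_simps)
  ultimately have "c = 0"
    using reduced_in_ideal_of_eq_0[of c] keys_c by simp
  then have red: "x (l, m) = 0" if "m \<in> ?M" "reduced V d m" for m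
    using lc[of m] that by simp
  have "g = 0"
    using cg \<open>c = 0\<close> by simp
  moreover have "g = (\<Sum>m\<in>?M. Const (x (l, m)) * rewrite_row V d G m)"
    unfolding g_def using red by (intro sum.cong) auto
  ultimately have "(\<Sum>m\<in>?M. Const (x (l, m)) * rewrite_row V d G m) = 0"
    by simp
  then have "(\<Sum>m\<in>?M. x (l, m) * lookup (rewrite_row V d G m) k) = 0" for k
    unfolding combination_eq by simp
  then have "x (l, m0) = 0"
    using indepD[OF indep, of "\<lambda>m. x (l, m)"] m0 by blast
  then show "x p = 0"
    by (simp add: lm)
qed

end

text \<open>
  A separable polynomial \<open>h\<close> of degree \<open>d\<close> in one variable, used for each variable, gives a system with
  diagonal Jacobian matrix.  If the characteristic does not divide \<open>d\<close>, take \<open>h = X\<^sup>d - 1\<close>, where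
  \<open>(X / d) h' = h + 1\<close>; otherwise take \<open>h = X\<^sup>d + X\<close>, where \<open>h' = 1\<close>.
\<close>

lemma ex_separable_direction:
  assumes V: "finite V" and d: "2 \<le> d" and t: "card V * (d - 1) + 1 \<le> t"
  obtains H :: "nat \<Rightarrow> 'a::{field,finite} mpoly"
  where "\<And>v. v \<in> V \<Longrightarrow> H v \<in> polys V d" "indep (jac_coeff V d H) (V \<times> monoms V t)"
proof -
  \<comment> \<open>The lower order term of \<open>h\<close>.\<close>
  define L where "L v = (if of_nat d = (0 :: 'a) then Var v else - 1 :: 'a mpoly)" for v
  define H where "H v = Var v ^ d + L v" for v
  have L: "L v \<in> polys V (d - 1)" if "v \<in> V" for v
    using that d by (auto simp: L_def Var_def monoms_def intro!: polys_uminus)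
  have H: "H v \<in> polys V d" if "v \<in> V" for v
    using that L[OF that] polys_mono[of "d - 1" d V] unfolding H_def Var_power
    by (intro polys_add) (auto simp: monoms_def)
  interpret rewriting_system V d H t
  proof
    show "indep (\<lambda>m. lookup (rewrite_row V d H m)) (monoms V t)"
      using V d L by (intro indep_rewrite_perturbed_powers) (auto simp: H_def Var_power)
  qed (use V d t H in auto)
  have pd_H: "pd l (H v) = (if v = l then Const (of_nat d) * Var v ^ (d - 1) + pd l (L v) else 0)" for l v
    by (simp add: H_def pd_add pd_Var_power L_def pd_Var)
  have "indep (jac_coeff V d H) (V \<times> monoms V t)"
  proof (rule indep_jac_of_diagonal)
    show "pd l (H j) = 0" if "j \<noteq> l" for j l
      using that by (simp add: pd_H)
    show "\<exists>u. vars u \<subseteq> V \<and> u * pd l (H l) - 1 \<in> ideal_of V" if l: "l \<in> V" for l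
    proof (cases "of_nat d = (0 :: 'a)")
      case True
      then have "pd l (H l) = 1"
        by (simp add: pd_H L_def pd_Var)
      then show ?thesis
        by (intro exI[of _ 1]) (simp add: ideal_0[OF ideal_of_is_ideal])
    next
      case False
      have "pd l (H l) = Const (of_nat d) * Var l ^ (d - 1)"
        using False by (simp add: pd_H L_def)
      then have "Const (inverse (of_nat d)) * Var l * pd l (H l) - 1
          = Const (inverse (of_nat d) * of_nat d) * (Var l * Var l ^ (d - 1)) - 1"
        by (simp add: Const_mult mult_ac)
      also have "Var l * Var l ^ (d - 1) = (Var l ^ d :: 'a mpoly)"
        using d by (simp add: power_eq_if)
      also have "Const (inverse (of_nat d) * of_nat d) * Var l ^ d - 1 = H l"
        using False by (simp add: H_def L_def)
      finally show ?thesis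
        using l by (intro exI[of _ "Const (inverse (of_nat d)) * Var l"])
          (simp add: gen_ideal_generator vars_mult_subset)
    qed
  qed
  with H show ?thesis
    by (rule that)
qed

section \<open>A binomial estimate\<close>

text \<open>
  For \<open>m \<ge> 2\<close> this follows from \<open>(1 + 1 / m)\<^sup>m \<le> e \<le> 3\<close>; for \<open>m = 1\<close> the bound \<open>3\<close> is too weak.
\<close>

lemma four_mult_Suc_power_le:
  assumes "1 \<le> (m :: nat)"
  shows "4 * (m + 1) ^ m \<le> 3 * (m + 2) * m ^ m"
proof (cases "m = 1")
  case False
  with assms have m: "2 \<le> m"
    by simp
  have "(1 + 1 / real m) ^ m \<le> exp (1 / real m) ^ m"
    by (intro power_mono) auto
  also have "\<dots> = exp 1"
    using m by (simp add: exp_of_nat_mult[symmetric])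
  also have "\<dots> \<le> 3"
    by (rule exp_le)
  finally have "(1 + 1 / real m) ^ m * real m ^ m \<le> 3 * real m ^ m"
    by (rule mult_right_mono) simp
  then have "(real m + 1) ^ m \<le> 3 * real m ^ m"
  proof -
    have "(1 + 1 / real m) * real m = real m + 1"
      using m by (simp add: field_simps)
    with \<open>(1 + 1 / real m) ^ m * real m ^ m \<le> 3 * real m ^ m\<close> show ?thesis
      by (simp add: power_mult_distrib[symmetric])
  qed
  then have "real ((m + 1) ^ m) \<le> real (3 * m ^ m)"
    by (simp add: add.commute)
  then have "(m + 1) ^ m \<le> 3 * m ^ m"
    by (simp only: of_nat_le_iff)
  then have "4 * (m + 1) ^ m \<le> 12 * m ^ m"
    by simp
  also have "\<dots> \<le> 3 * (m + 2) * m ^ m"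
    using m by (intro mult_right_mono) auto
  finally show ?thesis .
qed simp

text \<open>
  Raising the upper index from \<open>n + i\<close> to \<open>n + i + 1\<close> multiplies the binomial coefficient by
  \<open>(n + i + 1) / (n + i + 1 - k)\<close>, which is at most \<open>d / (d - 1)\<close> if \<open>d k \<le> n\<close>.
\<close>

lemma choose_shift_le:
  assumes "d * k \<le> n" "1 \<le> d"
  shows "((n + i) choose k) * (d - 1) ^ i \<le> d ^ i * (n choose k)"
proof (induction i)
  case (Suc i)
  have k: "k \<le> n + i"
    using assms mult_le_mono1[of 1 d k] by linarith
  have step: "(Suc (n + i) - k) * (Suc (n + i) choose k) = Suc (n + i) * ((n + i) choose k)"
    using k by (metis Suc_diff_le binomial_absorb_comp diff_Suc_1 Suc_diff_le)
  have le: "Suc (n + i) * (d - 1) \<le> d * (Suc (n + i) - k)"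
  proof -
    have "d * k \<le> Suc (n + i)"
      using assms by simp
    moreover obtain w where w: "Suc (n + i) = w + k"
      using k by (metis le_SucI le_add_diff_inverse2)
    moreover obtain p where p: "d = Suc p"
      using assms(2) by (cases d) auto
    ultimately show ?thesis
      unfolding w p by (simp add: algebra_simps)
  qed
  have pos: "0 < Suc (n + i) - k"
    using k by simp
  have "(Suc (n + i) - k) * ((Suc (n + i) choose k) * (d - 1) ^ Suc i)
      = (Suc (n + i) * (d - 1)) * (((n + i) choose k) * (d - 1) ^ i)"
  proof -
    have "(Suc (n + i) - k) * ((Suc (n + i) choose k) * (d - 1) ^ Suc i)
        = ((Suc (n + i) - k) * (Suc (n + i) choose k)) * (d - 1) ^ Suc i"
      by (simp only: mult.assoc)
    then show ?thesis
      unfolding step by (simp only: power_Suc mult_ac)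
  qed
  also have "\<dots> \<le> (d * (Suc (n + i) - k)) * (d ^ i * (n choose k))"
    by (intro mult_le_mono le Suc.IH)
  also have "\<dots> = (Suc (n + i) - k) * (d ^ Suc i * (n choose k))"
    by (simp add: mult_ac)
  finally show ?case
    using pos by simp
qed simp

text \<open>
  Induction on \<open>s\<close>.  In the step from \<open>s\<close> to \<open>s + 1\<close> the binomial coefficient grows at most by the factor
  \<open>d (d / (d - 1))\<^bsup>d - 1\<^esup>\<close>, and \<open>(s + 2) / (s + 1) \<le> 4 / 3\<close> since \<open>s \<ge> 2\<close>; the product is at most
  \<open>d (d + 1)\<close> by \<open>four_mult_Suc_power_le\<close>.
\<close>

lemma Suc_mult_choose_le:
  assumes d: "2 \<le> d" and s: "2 \<le> s"
  shows "(s + 1) * (((s + 1) * d - 1) choose s) \<le> 2 * (d * (d + 1)) ^ s"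
  using s
proof (induction s rule: dec_induct)
  case base
  have "2 * (3 * ((3 * d - 1) choose 2)) \<le> 3 * ((3 * d - 1) * (3 * d - 1 - 1))"
    by (simp add: choose_two)
  also have "\<dots> \<le> 3 * ((3 * d) * (3 * d))"
    by (intro mult_le_mono) auto
  also have "\<dots> \<le> 4 * ((d * 3) * (d * 3))"
    by simp
  also have "\<dots> \<le> 4 * ((d * (d + 1)) * (d * (d + 1)))"
    using d by (intro mult_le_mono) auto
  finally have "3 * ((3 * d - 1) choose 2) \<le> 2 * (d * (d + 1)) ^ 2"
    by (simp add: power2_eq_square)
  then show ?case
    by (simp add: numeral_eq_Suc)
next
  case (step s)
  let ?m = "d - 1"
  \<comment> \<open>With \<open>n = (s + 1) d\<close> the binomial coefficients for \<open>s\<close> and \<open>s + 1\<close> have upper indices \<open>n - 1\<close> and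
    \<open>n + (d - 1)\<close>; the passage from \<open>n - 1\<close> to \<open>n\<close> with the lower index raised gives the factor \<open>d\<close>.\<close>
  define n where "n = (s + 1) * d"
  have n: "1 \<le> n" "d * (s + 1) \<le> n"
    using d by (simp_all add: n_def)
  have "(s + 1) * (n choose (s + 1)) = n * ((n - 1) choose s)"
    using binomial_absorption[of s n] by simp
  also have "\<dots> = (s + 1) * (d * ((n - 1) choose s))"
    by (simp only: n_def mult.assoc)
  finally have "(s + 1) * (n choose (s + 1)) = (s + 1) * (d * ((n - 1) choose s))" .
  then have c: "n choose (s + 1) = d * ((n - 1) choose s)"
    by (simp only: mult_cancel1) simp
  have "((n + ?m) choose (s + 1)) * ?m ^ ?m \<le> d ^ ?m * (n choose (s + 1))"
    using n d by (intro choose_shift_le) auto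
  then have shift: "((n + ?m) choose (s + 1)) * ?m ^ ?m \<le> d ^ ?m * (d * ((n - 1) choose s))"
    unfolding c .
  have pw: "4 * d ^ ?m \<le> 3 * (d + 1) * ?m ^ ?m"
    using four_mult_Suc_power_le[of ?m] d by simp
  have "4 * (s + 1) * ((s + 2) * ((n + ?m) choose (s + 1)) * ?m ^ ?m)
      \<le> 4 * (s + 1) * ((s + 2) * (d ^ ?m * (d * ((n - 1) choose s))))"
    unfolding mult.assoc by (intro mult_le_mono2 shift)
  also have "\<dots> = (4 * d ^ ?m) * ((s + 2) * d) * ((s + 1) * ((n - 1) choose s))"
    by (simp only: mult_ac)
  also have "\<dots> \<le> (3 * (d + 1) * ?m ^ ?m) * ((s + 2) * d) * (2 * (d * (d + 1)) ^ s)"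
    by (rule mult_le_mono[OF mult_le_mono[OF pw le_refl] step.IH[folded n_def]])
  also have "\<dots> = (3 * (s + 2)) * (2 * (d * (d + 1)) ^ Suc s * ?m ^ ?m)"
    by (simp only: power_Suc mult_ac)
  also have "\<dots> \<le> (4 * (s + 1)) * (2 * (d * (d + 1)) ^ Suc s * ?m ^ ?m)"
    using step.hyps by (intro mult_le_mono1) simp
  finally have "(4 * (s + 1)) * ((s + 2) * ((n + ?m) choose (s + 1)) * ?m ^ ?m)
      \<le> (4 * (s + 1)) * (2 * (d * (d + 1)) ^ Suc s * ?m ^ ?m)" .
  then have "(s + 2) * ((n + ?m) choose (s + 1)) * ?m ^ ?m \<le> 2 * (d * (d + 1)) ^ Suc s * ?m ^ ?m"
    by (subst (asm) nat_mult_le_cancel1) simp_all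
  then have "(s + 2) * ((n + ?m) choose (s + 1)) \<le> 2 * (d * (d + 1)) ^ Suc s"
    using d by (subst (asm) mult_le_cancel2) auto
  moreover have "(Suc s + 1) * d - 1 = n + ?m"
    using d by (simp add: n_def algebra_simps)
  ultimately show ?case
    by simp
qed

section \<open>Partial evaluation\<close>

lemma partial_eval_lin:
  "partial_eval a = lin (\<lambda>m. \<Prod>i\<in>keys m. (if i \<in> {1..length a} then Const (a ! (i - 1)) else Var i) ^ lookup m i)"
  by (simp add: partial_eval_def poly_subst_def lin_def fun_eq_iff)

lemma partial_eval_fixed:
  assumes "f \<in> polys V d" "V \<inter> {1..length a} = {}"
  shows "partial_eval a f = f"
proof -
  have "partial_eval a f = lin mon f"
    unfolding partial_eval_lin
  proof (rule lin_cong)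
    fix m assume "m \<in> keys f"
    then have "keys m \<inter> {1..length a} = {}"
      using assms by (auto simp: polys_def monoms_def)
    then show "(\<Prod>i\<in>keys m. (if i \<in> {1..length a} then Const (a ! (i - 1)) else Var i) ^ lookup m i) = mon m"
      unfolding mon_prod[symmetric] by (intro prod.cong) auto
  qed
  then show ?thesis
    by simp
qed

lemma partial_eval_polys:
  assumes "f \<in> polys (V \<union> {1..length a}) d"
  shows "partial_eval a f \<in> polys V d"
  unfolding partial_eval_lin
proof (rule lin_in_polys)
  fix m assume "m \<in> keys f"
  then have m: "keys m \<subseteq> V \<union> {1..length a}" "mono_degree m \<le> d"
    using assms by (auto simp: polys_def monoms_def)
  have "(if i \<in> {1..length a} then Const (a ! (i - 1)) else Var i) ^ lookup m i \<in> polys V (lookup m i * 1)"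
    if "i \<in> keys m" for i
    using that m(1) by (intro polys_power) (auto simp: Var_def monoms_def)
  then have "(\<Prod>i\<in>keys m. (if i \<in> {1..length a} then Const (a ! (i - 1)) else Var i) ^ lookup m i)
      \<in> polys V (\<Sum>i\<in>keys m. lookup m i * 1)"
    by (rule polys_prod)
  then show "(\<Prod>i\<in>keys m. (if i \<in> {1..length a} then Const (a ! (i - 1)) else Var i) ^ lookup m i) \<in> polys V d"
    using m(2) polys_mono[of "mono_degree m" d V] by (auto simp: mono_degree_def)
qed

section \<open>Regular sequences in the ring of polynomials\<close>

lemma poly_ring_simps [simp]:
  "carrier (poly_ring V) = {f. vars f \<subseteq> V}"
  "f \<otimes>\<^bsub>poly_ring V\<^esub> g = f * g" "f \<oplus>\<^bsub>poly_ring V\<^esub> g = f + g"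
  "\<one>\<^bsub>poly_ring V\<^esub> = 1" "\<zero>\<^bsub>poly_ring V\<^esub> = 0"
  by (simp_all add: poly_ring_def)

lemma poly_ring_pow [simp]:
  fixes f :: "'a::comm_ring_1 mpoly"
  shows "f [^]\<^bsub>poly_ring V\<^esub> (n::nat) = f ^ n"
proof -
  interpret cring "poly_ring V :: 'a mpoly ring"
    by (rule cring_poly_ring)
  show ?thesis
    by (induction n) (simp_all add: mult.commute)
qed

lemma ideal_poly_ring_iff:
  fixes I :: "'a::comm_ring_1 mpoly set"
  shows "ideal I (poly_ring V) \<longleftrightarrow> is_ideal V I"
proof
  interpret R: cring "poly_ring V :: 'a mpoly ring"
    by (rule cring_poly_ring)
  show "is_ideal V I" if "ideal I (poly_ring V)"
  proof -
    interpret ideal I "poly_ring V" by fact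
    show ?thesis
      unfolding is_ideal_def
      using a_subset zero_closed a_closed I_l_closed by auto
  qed
  show "ideal I (poly_ring V)" if I: "is_ideal V I"
  proof (rule idealI[OF R.ring_axioms])
    show "subgroup I (add_monoid (poly_ring V))"
    proof (rule R.add.subgroupI)
      show "I \<subseteq> carrier (poly_ring V)"
        using ideal_vars[OF I] by auto
      show "I \<noteq> {}"
        using ideal_0[OF I] by blast
      show "\<ominus>\<^bsub>poly_ring V\<^esub> f \<in> I" if f: "f \<in> I" for f
      proof -
        have "\<ominus>\<^bsub>poly_ring V\<^esub> f = - f"
          using ideal_vars[OF I f] by (intro R.minus_equality) simp_all
        then show ?thesis
          using ideal_uminus[OF I f] by simp
      qed
      show "f \<oplus>\<^bsub>poly_ring V\<^esub> g \<in> I" if "f \<in> I" "g \<in> I" for f g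
        using ideal_add[OF I] that by simp
    qed
  qed (use ideal_mult[OF I] ideal_mult_right[OF I] in auto)
qed

lemma genideal_poly_ring:
  fixes G :: "'i \<Rightarrow> 'a::comm_ring_1 mpoly"
  assumes "finite W" "\<And>w. w \<in> W \<Longrightarrow> vars (G w) \<subseteq> V"
  shows "Idl\<^bsub>poly_ring V\<^esub> (G ` W) = gen_ideal V G W"
proof -
  interpret R: cring "poly_ring V :: 'a mpoly ring"
    by (rule cring_poly_ring)
  have sub: "G ` W \<subseteq> carrier (poly_ring V)"
    using assms(2) by auto
  show ?thesis
  proof
    show "Idl\<^bsub>poly_ring V\<^esub> (G ` W) \<subseteq> gen_ideal V G W"
      using is_ideal_gen_ideal[OF assms(2)] gen_ideal_generator[OF assms(1)]
      by (intro R.genideal_minimal) (auto simp: ideal_poly_ring_iff)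
    show "gen_ideal V G W \<subseteq> Idl\<^bsub>poly_ring V\<^esub> (G ` W)"
      using R.genideal_ideal[OF sub] R.genideal_self[OF sub]
      by (intro gen_ideal_least) (auto simp: ideal_poly_ring_iff)
  qed
qed

text \<open>
  Translation of the conditions on cosets in the definition of a regular sequence into conditions on
  polynomials.
\<close>

lemma quotient_regular:
  fixes I :: "'a::comm_ring_1 mpoly set"
  assumes I: "is_ideal V I" and g: "vars g \<subseteq> V" "g \<notin> I"
    and nzd: "\<And>f. vars f \<subseteq> V \<Longrightarrow> g * f \<in> I \<Longrightarrow> f \<in> I"
  shows "let Q = poly_ring V Quot I; x = I +>\<^bsub>poly_ring V\<^esub> g in x \<noteq> \<zero>\<^bsub>Q\<^esub> \<and> \<not> zero_divisor Q x"
proof -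
  interpret R: cring "poly_ring V :: 'a mpoly ring"
    by (rule cring_poly_ring)
  have id: "ideal I (poly_ring V)"
    using I by (simp add: ideal_poly_ring_iff)
  interpret ideal I "poly_ring V" by (fact id)
  have coset: "I +>\<^bsub>poly_ring V\<^esub> f = I \<longleftrightarrow> f \<in> I" if "vars f \<subseteq> V" for f
    using that R.a_coset_join1[of I f] R.a_coset_join2[of f I] a_subgroup by auto
  have "f \<in> I" if f: "vars f \<subseteq> V" and "rcoset_mult (poly_ring V) I (I +>\<^bsub>poly_ring V\<^esub> g) (I +>\<^bsub>poly_ring V\<^esub> f) = I" for f
  proof -
    have "I +>\<^bsub>poly_ring V\<^esub> (g * f) = I"
      using that g rcoset_mult_add[of g f] by simp
    then show ?thesis
      using coset[of "g * f"] nzd[OF f] f g by (simp add: vars_mult_subset)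
  qed
  then show ?thesis
    using coset[OF g(1)] g(2) coset
    by (auto simp: Let_def zero_divisor_def FactRing_def A_RCOSETS_def')
qed

context rewriting_system
begin

lemma reduced_regular_sequence_of_radical_closed:
  assumes rad: "radical_closed V" and xs: "distinct xs" "set xs = V" "xs \<noteq> []"
  shows "reduced_regular_sequence (poly_ring V) (map G xs)"
proof -
  let ?R = "poly_ring V :: 'a mpoly ring"
  have Idl: "Idl\<^bsub>?R\<^esub> (set (take i (map G xs))) = ideal_of (set (take i xs))" for i
    using set_take_subset[of i xs] xs(2) G_vars
    by (subst genideal_poly_ring[symmetric]) (auto simp: take_map)
  have sub: "set (take i xs) \<subseteq> V" for i
    using set_take_subset[of i xs] xs(2) by blast
  have nth: "xs ! i \<in> V" "xs ! i \<notin> set (take i xs)" if "i < length xs" for i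
  proof -
    show "xs ! i \<in> V"
      using that xs(2) by auto
    show "xs ! i \<notin> set (take i xs)"
      using that xs(1) by (auto simp: in_set_conv_nth nth_eq_iff_index_eq)
  qed
  have proper: "Idl\<^bsub>?R\<^esub> (set (map G xs)) \<noteq> carrier ?R"
    using Idl[of "length xs"] xs(2) one_notin_ideal_of[of V] by auto
  have first: "map G xs ! 0 \<noteq> 0"
    using nth[of 0] xs(3) generator_notin_ideal_of[of "xs ! 0" "{}"] ideal_0[OF ideal_of_is_ideal[of "{}"]]
    by (metis empty_subsetI insert_subset length_greater_0_conv list.set(1) nth_map take0)
  have step: "let I = ideal_of (set (take i xs)); Q = ?R Quot I; g = I +>\<^bsub>?R\<^esub> (G (xs ! i))
      in g \<noteq> \<zero>\<^bsub>Q\<^esub> \<and> \<not> zero_divisor Q g" if i: "i < length xs" for i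
  proof -
    have ins: "insert (xs ! i) (set (take i xs)) \<subseteq> V"
      using nth(1)[OF i] sub by blast
    show ?thesis
      using quotient_regular[OF ideal_of_is_ideal[OF sub] G_vars[OF nth(1)[OF i]]
          generator_notin_ideal_of[OF ins nth(2)[OF i]] nonzerodivisor[OF ins nth(2)[OF i]]]
      by (simp add: Let_def)
  qed
  have "regular_sequence ?R (map G xs)"
    unfolding regular_sequence_def
  proof (intro conjI ballI)
    show "set (map G xs) \<subseteq> carrier ?R"
      using G_vars xs(2) by auto
    show "let I = Idl\<^bsub>?R\<^esub> (set (take (i - 1) (map G xs))); Q = ?R Quot I; g = I +>\<^bsub>?R\<^esub> (map G xs ! (i - 1))
      in g \<noteq> \<zero>\<^bsub>Q\<^esub> \<and> \<not> zero_divisor Q g" if "i \<in> {2..length (map G xs)}" for i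
    proof -
      have "i - 1 < length xs"
        using that by auto
      from step[OF this] this show ?thesis
        by (simp only: Idl nth_map)
    qed
  qed (use proper first xs(3) in auto)
  moreover have "radical_ideal ?R (Idl\<^bsub>?R\<^esub> (set (take i (map G xs))))" for i
    unfolding Idl radical_ideal_def radical_def
  proof
    show "ideal (ideal_of (set (take i xs))) ?R"
      by (simp add: ideal_poly_ring_iff ideal_of_is_ideal[OF sub])
    have "f \<in> ideal_of (set (take i xs))" if "vars f \<subseteq> V" "f ^ n \<in> ideal_of (set (take i xs))" for f n
      using radical_closed_subset[OF rad sub] that unfolding radical_closed_def by blast
    moreover have "f ^ 1 \<in> ideal_of (set (take i xs))" if "f \<in> ideal_of (set (take i xs))" for f
      using that by simp
    ultimately show "{x \<in> carrier ?R. \<exists>n::nat. x [^]\<^bsub>?R\<^esub> n \<in> ideal_of (set (take i xs))} = ideal_of (set (take i xs))"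
      using ideal_vars[OF ideal_of_is_ideal[OF sub]] unfolding poly_ring_simps poly_ring_pow by blast
  qed
  ultimately show ?thesis
    unfolding reduced_regular_sequence_def by blast
qed

end

section \<open>Counting systems\<close>

text \<open>
  The entries of the list \<open>Fs\<close>, counted from 0, are assigned in order to the variables that are left after
  the substitution, the first of which has the index \<open>length a + 1\<close>.
\<close>

definition restricted_system :: "'a list \<Rightarrow> 'a mpoly list \<Rightarrow> nat \<Rightarrow> 'a::comm_ring_1 mpoly" where
  "restricted_system a Fs v = partial_eval a (Fs ! (v - length a - 1))"

lemma partial_eval_shift:
  assumes "h \<in> polys V d" "V \<inter> {1..length a} = {}"
  shows "partial_eval a (f + Const c * h) = partial_eval a f + Const c * h"
  using partial_eval_fixed[OF assms] by (simp add: partial_eval_lin lin_add lin_Const_mult)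

text \<open>
  The lines \<open>F + c H\<close> in the space of all lists of \<open>s\<close> polynomials of degree at most \<open>d\<close> in all variables.
  As \<open>H\<close> involves only variables that are not evaluated, partial evaluation maps such a line to a line
  with the same direction.
\<close>

lemma card_bad_systems_le:
  fixes a :: "'a::{field,finite} list" and s d :: nat
  defines "V \<equiv> {length a + 1..length a + s}"
    and "FF \<equiv> {Fs. set Fs \<subseteq> polys_upto (length a + s) d \<and> length Fs = s}"
  assumes H: "\<And>v. v \<in> V \<Longrightarrow> H v \<in> polys V d"
    and cong: "\<And>G G'. (\<And>v. v \<in> V \<Longrightarrow> G v = G' v) \<Longrightarrow> P G \<Longrightarrow> P G'"
    and le: "\<And>G. card {c. P (\<lambda>v. G v + Const c * H v)} \<le> D"
  shows "CARD('a) * card {Fs \<in> FF. P (restricted_system a Fs)} \<le> card FF * D"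
proof -
  define \<tau> where "\<tau> c Fs = map (\<lambda>i. Fs ! i + Const c * H (i + length a + 1)) [0..<s]" for c and Fs :: "'a mpoly list"
  have fin: "finite FF"
    unfolding FF_def by (intro finite_lists_length_eq finite_polys_upto)
  have V: "V \<subseteq> {1..length a + s}" "V \<inter> {1..length a} = {}"
    by (auto simp: V_def)
  have HV: "H (i + length a + 1) \<in> polys V d" if "i < s" for i
    using that by (intro H) (auto simp: V_def)
  have bij: "bij_betw (\<tau> c) FF FF" for c
  proof -
    have inj: "inj_on (\<tau> c) FF"
    proof (rule inj_onI)
      fix Fs Gs assume "Fs \<in> FF" "Gs \<in> FF" and eq: "\<tau> c Fs = \<tau> c Gs"
      then have len: "length Fs = s" "length Gs = s"
        by (simp_all add: FF_def)
      have "Fs ! i = Gs ! i" if "i < s" for i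
        using arg_cong[OF eq, of "\<lambda>xs. xs ! i"] that by (simp add: \<tau>_def)
      with len show "Fs = Gs"
        by (intro nth_equalityI) auto
    qed
    moreover have "\<tau> c ` FF \<subseteq> FF"
    proof (rule image_subsetI)
      fix Fs assume Fs: "Fs \<in> FF"
      have "Fs ! i + Const c * H (i + length a + 1) \<in> polys {1..length a + s} d" if i: "i < s" for i
      proof (intro polys_add polys_Const_mult)
        have "Fs ! i \<in> set Fs"
          using Fs i by (simp add: FF_def)
        then show "Fs ! i \<in> polys {1..length a + s} d"
          using Fs by (auto simp: FF_def polys_upto_eq)
        show "H (i + length a + 1) \<in> polys {1..length a + s} d"
          using HV[OF i] V(1) by (auto simp: polys_def monoms_def)
      qed
      then show "\<tau> c Fs \<in> FF"
        by (auto simp: FF_def \<tau>_def polys_upto_eq)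
    qed
    ultimately show ?thesis
      using fin by (simp add: bij_betw_def endo_inj_surj)
  qed
  have "card {c. P (restricted_system a (\<tau> c Fs))} \<le> D" for Fs
  proof -
    have "restricted_system a (\<tau> c Fs) v = restricted_system a Fs v + Const c * H v" if v: "v \<in> V" for c v
    proof -
      have i: "v - length a - 1 < s" "v - length a - 1 + length a + 1 = v"
        using v by (auto simp: V_def)
      then have "restricted_system a (\<tau> c Fs) v = partial_eval a (Fs ! (v - length a - 1) + Const c * H v)"
        by (simp add: restricted_system_def \<tau>_def)
      then show ?thesis
        using partial_eval_shift[OF H[OF v] V(2)] by (simp add: restricted_system_def)
    qed
    then have "P (\<lambda>v. restricted_system a Fs v + Const c * H v)" if "P (restricted_system a (\<tau> c Fs))" for c
      using that by (rule cong)
    then have "{c. P (restricted_system a (\<tau> c Fs))} \<subseteq> {c. P (\<lambda>v. restricted_system a Fs v + Const c * H v)}"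
      by blast
    from order_trans[OF card_mono[OF finite this] le] show ?thesis .
  qed
  then show ?thesis
    by (intro card_bad_translates_le[OF fin bij])
qed

theorem theorem1p2:
  fixes q r s d N :: nat
    and a :: "'a::{field,finite} list"
    and FF :: "'a mpoly list set"
  assumes q: "q = CARD('a)"
    and "1 < s" "s < r" "d \<ge> 2"
    and a: "length a = r - s"
    and FF: "FF = {Fs. set Fs \<subseteq> polys_upto r d \<and> length Fs = s}"
    and N: "N = card {Fs \<in> FF.
              reduced_regular_sequence (poly_ring {r - s + 1..r}) (map (partial_eval a) Fs)}"
    and "q > 2 * d ^ s * (d + 1) ^ s"
  shows "1 - 2 * real d ^ s * (real d + 1) ^ s / real q \<le> real N / real (card FF) \<and>
         real N / real (card FF) \<le> 1"
proof -
  define V where "V = {r - s + 1..r}"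
  define t where "t = (s + 1) * (d - 1)"
  have V: "finite V" "card V = s" "V = {length a + 1..length a + s}" and r: "r = length a + s"
    using \<open>s < r\<close> a by (auto simp: V_def)
  have d: "0 < d" "2 \<le> d"
    using \<open>d \<ge> 2\<close> by auto
  have t_le: "card V * (d - 1) + 1 \<le> t" "(card V + 1) * (d - 1) \<le> t"
    using d by (auto simp: V(2) t_def)
  define unrewritable where "unrewritable G \<longleftrightarrow> \<not> indep (\<lambda>m. lookup (rewrite_row V d G m)) (monoms V t)"
    for G :: "nat \<Rightarrow> 'a mpoly"
  define degenerate where "degenerate G \<longleftrightarrow> \<not> indep (jac_coeff V d G) (V \<times> monoms V t)"
    for G :: "nat \<Rightarrow> 'a mpoly"
  define M where "M = card (monoms V t)"
  have FF': "FF = {Fs. set Fs \<subseteq> polys_upto (length a + s) d \<and> length Fs = s}"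
    using FF r by simp
  have fin: "finite FF"
    unfolding FF by (intro finite_lists_length_eq finite_polys_upto)
  have "replicate s 0 \<in> FF"
    by (auto simp: FF polys_upto_eq)
  then have FF_pos: "0 < card FF"
    using fin card_gt_0_iff by blast
  have good: "reduced_regular_sequence (poly_ring V) (map (partial_eval a) Fs)"
    if Fs: "Fs \<in> FF" and nb: "\<not> unrewritable (restricted_system a Fs)" "\<not> degenerate (restricted_system a Fs)" for Fs
  proof -
    let ?G = "restricted_system a Fs"
    have len: "length Fs = s"
      using Fs by (simp add: FF)
    interpret rewriting_system V d ?G t
    proof
      fix v assume v: "v \<in> V"
      have "Fs ! (v - length a - 1) \<in> set Fs"
        using v len by (auto simp: V(3))
      then have "Fs ! (v - length a - 1) \<in> polys {1..length a + s} d"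
        using Fs by (auto simp: FF' polys_upto_eq)
      moreover have "{1..length a + s} = V \<union> {1..length a}"
        by (auto simp: V(3))
      ultimately show "?G v \<in> polys V d"
        unfolding restricted_system_def by (intro partial_eval_polys) simp
    qed (use V d t_le nb in \<open>auto simp: unrewritable_def\<close>)
    have "radical_closed V"
      using t_le(2) nb(2) unfolding degenerate_def not_not by (rule radical_closed_of_indep_jac)
    then have "reduced_regular_sequence (poly_ring V) (map ?G [length a + 1..<length a + s + 1])"
      using \<open>1 < s\<close> by (intro reduced_regular_sequence_of_radical_closed) (auto simp: V(3))
    moreover have "map ?G [length a + 1..<length a + s + 1] = map (partial_eval a) Fs"
      by (rule nth_equalityI) (simp_all add: len restricted_system_def nth_upt del: upt_Suc)
    ultimately show ?thesis
      by simp
  qed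
  have unrewritable: "q * card {Fs \<in> FF. unrewritable (restricted_system a Fs)} \<le> card FF * M"
    unfolding q FF'
  proof (rule card_bad_systems_le[of a s "\<lambda>v. mon (vpow v d)"], unfold V(3)[symmetric])
    show "unrewritable G'" if "\<And>v. v \<in> V \<Longrightarrow> G v = G' v" "unrewritable G" for G G'
      using that rewrite_row_cong[of V G G' d] by (simp add: unrewritable_def)
    show "card {c. unrewritable (\<lambda>v. G v + Const c * mon (vpow v d))} \<le> M" for G
      unfolding unrewritable_def M_def by (rule card_bad_rewrite_le[OF V(1) d(1)])
  qed (auto simp: monoms_def)
  obtain H :: "nat \<Rightarrow> 'a mpoly" where H: "\<And>v. v \<in> V \<Longrightarrow> H v \<in> polys V d"
    "indep (jac_coeff V d H) (V \<times> monoms V t)"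
    using ex_separable_direction[OF V(1) d(2) t_le(1)] by blast
  have degenerate: "q * card {Fs \<in> FF. degenerate (restricted_system a Fs)} \<le> card FF * (s * M)"
    unfolding q FF'
  proof (rule card_bad_systems_le[of a s H], unfold V(3)[symmetric])
    show "degenerate G'" if eq: "\<And>v. v \<in> V \<Longrightarrow> G v = G' v" and "degenerate G" for G G'
    proof -
      have "indep (jac_coeff V d G) (V \<times> monoms V t) \<longleftrightarrow> indep (jac_coeff V d G') (V \<times> monoms V t)"
        by (intro indep_cong jac_coeff_cong eq) auto
      with that(2) show ?thesis
        by (simp add: degenerate_def)
    qed
    show "card {c. degenerate (\<lambda>v. G v + Const c * H v)} \<le> s * M" for G
      using card_bad_jac_le[OF V(1) H(2), of G] by (simp add: degenerate_def M_def V(2))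
  qed (use H in auto)
  define Good where "Good = {Fs \<in> FF. reduced_regular_sequence (poly_ring V) (map (partial_eval a) Fs)}"
  have N': "N = card Good"
    by (simp add: N Good_def V_def)
  let ?B1 = "{Fs \<in> FF. unrewritable (restricted_system a Fs)}"
  let ?B2 = "{Fs \<in> FF. degenerate (restricted_system a Fs)}"
  have "FF \<subseteq> Good \<union> (?B1 \<union> ?B2)"
    using good by (auto simp: Good_def)
  then have "card FF \<le> card (Good \<union> (?B1 \<union> ?B2))"
    using fin by (intro card_mono) (auto simp: Good_def)
  also have "\<dots> \<le> N + (card ?B1 + card ?B2)"
    unfolding N' using card_Un_le[of Good "?B1 \<union> ?B2"] card_Un_le[of ?B1 ?B2] by linarith
  finally have "q * card FF \<le> q * (N + (card ?B1 + card ?B2))"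
    by (rule mult_le_mono2)
  also have "\<dots> = q * N + (q * card ?B1 + q * card ?B2)"
    by (simp only: distrib_left)
  also have "\<dots> \<le> q * N + (card FF * M + card FF * (s * M))"
    by (intro add_mono unrewritable degenerate le_refl)
  also have "card FF * M + card FF * (s * M) = card FF * ((s + 1) * M)"
    by (simp add: algebra_simps)
  also have "q * N + card FF * ((s + 1) * M) \<le> q * N + card FF * (2 * d ^ s * (d + 1) ^ s)"
  proof -
    have "M \<le> (s + t) choose t"
      using finite_monoms_card_le[OF V(1), of t] by (simp add: M_def V(2))
    also have "\<dots> = (s + t) choose s"
      using binomial_symmetric[of s "s + t"] by simp
    also have "s + t = (s + 1) * d - 1"
      using d by (cases d) (simp_all add: t_def)
    finally have "(s + 1) * M \<le> (s + 1) * (((s + 1) * d - 1) choose s)"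
      by (rule mult_le_mono2)
    also have "\<dots> \<le> 2 * (d * (d + 1)) ^ s"
      using \<open>1 < s\<close> d by (intro Suc_mult_choose_le) auto
    also have "\<dots> = 2 * d ^ s * (d + 1) ^ s"
      by (simp only: power_mult_distrib mult.assoc)
    finally show ?thesis
      by (intro add_left_mono mult_le_mono2)
  qed
  finally have "real (q * card FF) \<le> real (q * N + card FF * (2 * d ^ s * (d + 1) ^ s))"
    by (simp only: of_nat_le_iff)
  then have main: "real q * real (card FF) \<le> real q * real N + real (card FF) * (2 * real d ^ s * (real d + 1) ^ s)"
    by (simp add: add.commute)
  have q_pos: "0 < real q"
    using \<open>q > 2 * d ^ s * (d + 1) ^ s\<close> by simp
  have "N \<le> card FF"
    unfolding N' Good_def using fin by (intro card_mono) auto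
  then have "real N / real (card FF) \<le> 1"
    using FF_pos by simp
  moreover have "1 - 2 * real d ^ s * (real d + 1) ^ s / real q \<le> real N / real (card FF)"
    using main q_pos FF_pos by (simp add: field_simps)
  ultimately show ?thesis
    by blast
qed

end
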